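(* For each $n\ge1$ let $X_n$ have the stationary distribution of the load balancing process $\boldsymbol{X}_n$ of the dandelion network $G_n$ with dispatchers $\{1,\dots,n\}$, central servers $C$ and boundary servers $B_1,\dots,B_n$, arrival rate $\lambda$ at every dispatcher and service rate $\mu$ at every server, where $\lambda<\mu|B_1|$. Let $D$ be a finite set of positive integers and $B_D=\{b\in B_d:d\in D\}$. Then $$(X_n(b):b\in B_D)\Rightarrow Y\quad\text{as } n\to\infty,$$ where $\Rightarrow$ denotes weak convergence and $Y$ is the random variable with values in $\mathbb{N}^{B_D}$ such that: (a) the random vectors $(Y(b):b\in B_d)$, $d\in D$, are independent and identically distributed; (b) for each $d \in D$, $(Y(b):b\in B_d)$ has the stationary distribution of a basic load balancing process where the dispatcher has arrival rate $\lambda$ and the $|B_d|$ servers each have service rate $\mu$.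
   Context: $\mathbb{N}=\{0,1,2,\dots\}$. Load balancing process: for a bipartite graph $G=(D,S,E)$ with finite sets $D$ (dispatchers), $S$ (servers), $E\subset D\times S$, and rates $\lambda:D\to(0,\infty)$, $\mu:S\to(0,\infty)$, dispatcher $d$ receives tasks as an independent Poisson process of rate $\lambda(d)$ and sends each task to a server chosen uniformly at random among the servers $u$ with $(d,u)\in E$ having the least number of tasks; each server $u$ executes tasks sequentially with independent exponential service times of rate $\mu(u)$. $\boldsymbol{X}(t,u)$ is the number of tasks in server $u$ at time $t$; $\boldsymbol{X}$ is a continuous-time Markov chain on $\mathbb{N}^S$. A basic load balancing process is a load balancing process with a single dispatcher compatible with all servers ($D=\{d\}$, $E=D\times S$) and constant rate functions. Dandelion networks: fix a finite set $C$ (central servers) and finite sets $B_1,B_2,\dots$ (boundary servers) of the same cardinality, all these sets being pairwise disjoint. For $n\ge1$, $G_n=(D_n,S_n,E_n)$ with $D_n=\{1,\dots,n\}$, $S_n=C\cup\bigcup_{d\in D_n}B_d$ and $E_n=\bigcup_{d\in D_n}\{d\}\times(B_d\cup C)$. $\boldsymbol{X}_n$ is the load balancing process associated with $G_n$ with constant arrival rate $\lambda>0$ and constant service rate $\mu>0$, $\lambda<\mu|B_1|$; under this condition $\boldsymbol{X}_n$ is ergodic. The convergence concerns $n\ge\max D$, so that $B_D\subset S_n$. *)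

theory Defs
  imports "HOL-Probability.Probability"
begin

definition weak_conv_on :: "'a topology \<Rightarrow> (nat \<Rightarrow> 'a measure) \<Rightarrow> 'a measure \<Rightarrow> bool" where
  "weak_conv_on T M N \<longleftrightarrow>
     (\<forall>f :: 'a \<Rightarrow> real. continuous_map T euclideanreal f \<and> bounded (f ` topspace T) \<longrightarrow>
        (\<lambda>n. integral\<^sup>L (M n) f) \<longlonglongrightarrow> integral\<^sup>L N f)"

abbreviation nat_vectors :: "'s set \<Rightarrow> ('s \<Rightarrow> nat) set" where
  "nat_vectors S \<equiv> S \<rightarrow>\<^sub>E UNIV"

abbreviation nat_vectors_topology :: "'s set \<Rightarrow> ('s \<Rightarrow> nat) topology" where
  "nat_vectors_topology S \<equiv> product_topology (\<lambda>_. discrete_topology UNIV) S"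

(* P t x is the law at time t of the continuous-time Markov chain on \<Omega> started from x, whose
   infinitesimal generator is Q: P(X(t) = y | X(0) = x) = (1 if x = y, else 0) + t Q(x, y) + o(t),
   the case x = y included.  For a generator that is bounded and conservative, as the ones below
   are, there is exactly one such P on \<Omega> for times t \<ge> 0. *)
definition markov_transition_function ::
    "'x set \<Rightarrow> ('x \<Rightarrow> 'x \<Rightarrow> real) \<Rightarrow> (real \<Rightarrow> 'x \<Rightarrow> 'x pmf) \<Rightarrow> bool" where
  "markov_transition_function \<Omega> Q P \<longleftrightarrow>
     (\<forall>t\<ge>0. \<forall>x\<in>\<Omega>. set_pmf (P t x) \<subseteq> \<Omega>) \<and>
     (\<forall>x\<in>\<Omega>. P 0 x = return_pmf x) \<and>
     (\<forall>s\<ge>0. \<forall>t\<ge>0. \<forall>x\<in>\<Omega>. P (s + t) x = bind_pmf (P s x) (P t)) \<and>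
     (\<forall>x\<in>\<Omega>. \<forall>y\<in>\<Omega>. ((\<lambda>t. pmf (P t x) y) has_real_derivative Q x y) (at 0 within {0..}))"

definition stationary_distribution ::
    "'x set \<Rightarrow> ('x \<Rightarrow> 'x \<Rightarrow> real) \<Rightarrow> 'x pmf \<Rightarrow> bool" where
  "stationary_distribution \<Omega> Q p \<longleftrightarrow> set_pmf p \<subseteq> \<Omega> \<and>
     (\<exists>P. markov_transition_function \<Omega> Q P \<and> (\<forall>t\<ge>0. bind_pmf p (P t) = p))"

definition has_stationary_distribution ::
    "'x set \<Rightarrow> ('x \<Rightarrow> 'x \<Rightarrow> real) \<Rightarrow> 'w measure \<Rightarrow> ('w \<Rightarrow> 'x) \<Rightarrow> bool" where
  "has_stationary_distribution \<Omega> Q M X \<longleftrightarrow> X \<in> measurable M (count_space \<Omega>) \<and>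
     (\<exists>p. stationary_distribution \<Omega> Q p \<and> distr M (count_space UNIV) X = measure_pmf p)"

definition least_loaded :: "('d \<times> 's) set \<Rightarrow> ('s \<Rightarrow> nat) \<Rightarrow> 'd \<Rightarrow> 's set" where
  "least_loaded E x d = {u. (d, u) \<in> E \<and> (\<forall>v. (d, v) \<in> E \<longrightarrow> x u \<le> x v)}"

(* Contribution to the (x, y) entry of a generator of a transition from x to z at unit rate. *)
definition jump :: "'x \<Rightarrow> 'x \<Rightarrow> 'x \<Rightarrow> real" where
  "jump x z y = of_bool (y = z) - of_bool (y = x)"

(* Each dispatcher d emits tasks at rate lam d, and the task joins a uniformly chosen element of
   least_loaded E x d; each nonempty server u completes a task at rate mu u. *)
definition load_balancing_generator ::
    "'d set \<Rightarrow> 's set \<Rightarrow> ('d \<times> 's) set \<Rightarrow> ('d \<Rightarrow> real) \<Rightarrow> ('s \<Rightarrow> real)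
      \<Rightarrow> ('s \<Rightarrow> nat) \<Rightarrow> ('s \<Rightarrow> nat) \<Rightarrow> real" where
  "load_balancing_generator D S E lam mu x y =
     (\<Sum>d\<in>D. \<Sum>u\<in>least_loaded E x d.
        lam d / real (card (least_loaded E x d)) * jump x (x(u := x u + 1)) y) +
     (\<Sum>u\<in>{u\<in>S. 0 < x u}. mu u * jump x (x(u := x u - 1)) y)"

definition basic_generator ::
    "'s set \<Rightarrow> real \<Rightarrow> real \<Rightarrow> ('s \<Rightarrow> nat) \<Rightarrow> ('s \<Rightarrow> nat) \<Rightarrow> real" where
  "basic_generator S lam mu =
     load_balancing_generator {()} S ({()} \<times> S) (\<lambda>_. lam) (\<lambda>_. mu)"

definition dandelion_servers :: "'s set \<Rightarrow> (nat \<Rightarrow> 's set) \<Rightarrow> nat \<Rightarrow> 's set" where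
  "dandelion_servers C B n = C \<union> (\<Union>d\<in>{1..n}. B d)"

definition dandelion_edges :: "'s set \<Rightarrow> (nat \<Rightarrow> 's set) \<Rightarrow> nat \<Rightarrow> (nat \<times> 's) set" where
  "dandelion_edges C B n = (SIGMA d:{1..n}. B d \<union> C)"

definition dandelion_generator ::
    "'s set \<Rightarrow> (nat \<Rightarrow> 's set) \<Rightarrow> real \<Rightarrow> real \<Rightarrow> nat
      \<Rightarrow> ('s \<Rightarrow> nat) \<Rightarrow> ('s \<Rightarrow> nat) \<Rightarrow> real" where
  "dandelion_generator C B lam mu n =
     load_balancing_generator {1..n} (dandelion_servers C B n) (dandelion_edges C B n)
       (\<lambda>_. lam) (\<lambda>_. mu)"

end

theory Submission
  imports Defs "HOL-Library.Diagonal_Subsequence"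
begin

text \<open>
  Under a stationary law the generator \<open>L\<close> satisfies \<open>E (L f) = 0\<close> for all bounded \<open>f\<close>, and at most one
  law has this property, because every state leads to the empty
  one. In the dandelion network uniqueness makes the dispatchers exchangeable, while flow balance bounds
  the total rate of tasks sent to \<open>C\<close> by the service capacity of \<open>C\<close>; hence a single dispatcher sees a
  central server among its least loaded ones with probability \<open>O(1/n)\<close>. So the law of the boundary
  servers in \<open>B\<^sub>D\<close> is invariant for independent basic processes up to an error \<open>O(1/n)\<close>. A quadratic
  Lyapunov function shows that these laws are tight uniformly in \<open>n\<close>, and every subsequential limit is
  invariant, hence equal to the law of \<open>Y\<close>.
\<close>

section \<open>Stationary laws of Markov transition functions\<close>

text \<open>\<open>stationary_distribution\<close> refers to a transition semigroup, but for a
  relabelled law, a subsequential limit or a product of basic laws no semigroup is at hand. The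
  identity \<open>E (L f) = 0\<close> needs none. It survives relabelling along an automorphism,
  pointwise limits of laws and independent products, and it already determines the law; so
  semigroups occur only where the identity is derived from stationarity.

  The restriction of the network law to the boundary servers of \<open>D\<close> is only
  approximately invariant, because central servers couple the dispatchers. This is why compactness
  and uniqueness are used instead of a direct identification.

  Loads are unbounded while the identity is restricted to bounded functions, so linear and quadratic
  test functions are truncated and the truncation is removed at the end. The operator itself is
  bounded, since service rates do not grow with the load; this makes the identity stable under
  limits.

  Stability enters through the quadratic function: with \<open>W\<close> tasks in \<open>B d\<close>
  and \<open>K = card (B d)\<close>, arrivals raise it at rate about \<open>2 * lam * W / K\<close>
  at most and services lower it at rate about \<open>2 * mu * W\<close>, so
  \<open>lam < mu * K\<close> is what makes the drift negative.\<close>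

lemma integrable_pmf_bounded:
  fixes f :: "'a \<Rightarrow> real"
  assumes "\<And>x. x \<in> set_pmf p \<Longrightarrow> \<bar>f x\<bar> \<le> b"
  shows "integrable (measure_pmf p) f"
  by (rule measure_pmf.integrable_const_bound[where B=b]) (use assms in \<open>auto simp: AE_measure_pmf_iff\<close>)

lemma abs_expectation_pmf_le:
  fixes f :: "'a \<Rightarrow> real"
  assumes "\<And>x. x \<in> set_pmf p \<Longrightarrow> \<bar>f x\<bar> \<le> b"
  shows "\<bar>measure_pmf.expectation p f\<bar> \<le> b"
proof -
  have i: "integrable (measure_pmf p) f" using integrable_pmf_bounded assms by blast
  have "measure_pmf.expectation p f \<le> b"
    by (rule measure_pmf.integral_le_const[OF i]) (use assms in \<open>force simp: AE_measure_pmf_iff\<close>)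
  moreover have "- b \<le> measure_pmf.expectation p f"
    by (rule measure_pmf.integral_ge_const[OF i]) (use assms in \<open>force simp: AE_measure_pmf_iff\<close>)
  ultimately show ?thesis by auto
qed

text \<open>Adding \<open>b\<close> makes \<open>f\<close> nonnegative, so that the tower property
  can be taken from \<open>nn_integral_bind_pmf\<close>; the shift is then removed among real
  numbers.\<close>

lemma expectation_bind_pmf_bounded:
  fixes f :: "'a \<Rightarrow> real"
  assumes b: "\<And>x. \<bar>f x\<bar> \<le> b"
  shows "measure_pmf.expectation (bind_pmf p K) f =
    measure_pmf.expectation p (\<lambda>x. measure_pmf.expectation (K x) f)"
proof -
  have i: "integrable (measure_pmf q) f" for q :: "'a pmf"
    using integrable_pmf_bounded[of q f b] b by auto
  have ge: "0 \<le> f x + b" for x using b[of x] by auto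
  have nn: "(\<integral>\<^sup>+x. ennreal (f x + b) \<partial>measure_pmf q) = ennreal (measure_pmf.expectation q f + b)" for q
  proof -
    have "(\<integral>\<^sup>+x. ennreal (f x + b) \<partial>measure_pmf q) = ennreal (measure_pmf.expectation q (\<lambda>x. f x + b))"
      by (rule nn_integral_eq_integral) (use ge i in auto)
    also have "measure_pmf.expectation q (\<lambda>x. f x + b) = measure_pmf.expectation q f + b"
      using i by (subst Bochner_Integration.integral_add) auto
    finally show ?thesis .
  qed
  have le: "\<bar>measure_pmf.expectation q f\<bar> \<le> b" for q
    by (rule abs_expectation_pmf_le) (rule b)
  have i2: "integrable (measure_pmf p) (\<lambda>x. measure_pmf.expectation (K x) f)"
    using le by (rule integrable_pmf_bounded)
  have ge2: "0 \<le> measure_pmf.expectation q f + b" for q using le[of q] by auto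
  have "ennreal (measure_pmf.expectation (bind_pmf p K) f + b)
      = (\<integral>\<^sup>+x. ennreal (measure_pmf.expectation (K x) f + b) \<partial>measure_pmf p)"
    by (simp only: nn[symmetric] nn_integral_bind_pmf)
  also have "\<dots> = ennreal (measure_pmf.expectation p (\<lambda>x. measure_pmf.expectation (K x) f + b))"
    by (rule nn_integral_eq_integral) (use ge2 i2 in auto)
  also have "measure_pmf.expectation p (\<lambda>x. measure_pmf.expectation (K x) f + b)
      = measure_pmf.expectation p (\<lambda>x. measure_pmf.expectation (K x) f) + b"
    using i2 by (subst Bochner_Integration.integral_add) auto
  finally show ?thesis
    using ge2 le by (subst (asm) ennreal_inj) (auto simp: abs_le_iff, smt (verit, best) abs_expectation_pmf_le)
qed

text \<open>The error is the integral over the complement of \<open>A\<close>. It is expressed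
  through the point masses inside \<open>A\<close>, because these are what the derivative condition
  on a transition function controls.\<close>

lemma expectation_finite_split:
  fixes f :: "'a \<Rightarrow> real"
  assumes b: "\<And>x. \<bar>f x\<bar> \<le> b" and A: "finite A"
  shows "\<bar>measure_pmf.expectation p f - (\<Sum>y\<in>A. pmf p y * f y)\<bar> \<le> b * (1 - (\<Sum>y\<in>A. pmf p y))"
proof -
  have b0: "0 \<le> b" using b[of undefined] by linarith
  have i1: "integrable (measure_pmf p) (\<lambda>x. f x * indicator A x)"
    by (intro integrable_pmf_bounded[of p _ b]) (auto split: split_indicator simp: b b0)
  have i2: "integrable (measure_pmf p) (\<lambda>x. f x * indicator (-A) x)"
    by (intro integrable_pmf_bounded[of p _ b]) (auto split: split_indicator simp: b b0)
  have "measure_pmf.expectation p f = measure_pmf.expectation p (\<lambda>x. f x * indicator A x + f x * indicator (-A) x)"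
    by (intro Bochner_Integration.integral_cong) (auto simp: indicator_def)
  also have "\<dots> = measure_pmf.expectation p (\<lambda>x. f x * indicator A x) + measure_pmf.expectation p (\<lambda>x. f x * indicator (-A) x)"
    using i1 i2 by (rule Bochner_Integration.integral_add)
  also have "measure_pmf.expectation p (\<lambda>x. f x * indicator A x) = (\<Sum>y\<in>A. pmf p y * f y)"
    by (subst integral_measure_pmf_real[where A=A]) (use A in \<open>auto simp: indicator_eq_0_iff mult.commute intro!: sum.cong\<close>)
  finally have 1: "measure_pmf.expectation p f - (\<Sum>y\<in>A. pmf p y * f y) = measure_pmf.expectation p (\<lambda>x. f x * indicator (-A) x)"
    by simp
  have "\<bar>measure_pmf.expectation p (\<lambda>x. f x * indicator (-A) x)\<bar> \<le> measure_pmf.expectation p (\<lambda>x. \<bar>f x * indicator (-A) x\<bar>)"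
    by (rule integral_abs_bound)
  also have "\<dots> \<le> measure_pmf.expectation p (\<lambda>x. b * indicator (-A) x)"
    by (intro integral_mono integrable_abs i2 integrable_pmf_bounded[of p _ b])
       (auto split: split_indicator simp: b b0)
  also have "\<dots> = b * (1 - measure p A)"
    using measure_pmf.prob_compl[of A p] by (simp add: Compl_eq_Diff_UNIV)
  also have "measure p A = (\<Sum>y\<in>A. pmf p y)"
    using A by (rule measure_measure_pmf_finite)
  finally show ?thesis unfolding 1 .
qed

lemma filterlim_const_over_Suc:
  assumes "0 < (c::real)"
  shows "filterlim (\<lambda>n. c / real (Suc n)) (at 0 within {0..}) sequentially"
  unfolding filterlim_at
proof
  show "\<forall>\<^sub>F n in sequentially. c / real (Suc n) \<in> {0..} \<and> c / real (Suc n) \<noteq> 0"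
    using assms by (intro always_eventually allI) simp
  show "(\<lambda>n. c / real (Suc n)) \<longlonglongrightarrow> 0"
    by (rule LIMSEQ_Suc[OF lim_const_over_n])
qed

lemma tendsto_pmf_expectation_bounded:
  fixes f :: "nat \<Rightarrow> 'a \<Rightarrow> real"
  assumes "\<And>n x. x \<in> set_pmf p \<Longrightarrow> \<bar>f n x\<bar> \<le> b"
    and "\<And>x. x \<in> set_pmf p \<Longrightarrow> (\<lambda>n. f n x) \<longlonglongrightarrow> g x"
  shows "(\<lambda>n. measure_pmf.expectation p (f n)) \<longlonglongrightarrow> measure_pmf.expectation p g"
  by (rule integral_dominated_convergence[where w="\<lambda>_. b"])
     (use assms in \<open>auto simp: AE_measure_pmf_iff\<close>)

text \<open>The escape probability \<open>\<phi> t = 1 - pmf (P t x) x\<close> is subadditive, so \<open>\<phi> t \<le> n \<phi> (t / n)\<close>, and the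
  right-hand side tends to \<open>t\<close> times the derivative of \<open>\<phi>\<close> at 0.\<close>
lemma markov_transition_escape_le:
  assumes P: "markov_transition_function \<Omega> Q P" and x: "x \<in> \<Omega>" and t: "0 \<le> t"
  shows "1 - pmf (P t x) x \<le> t * (- Q x x)"
proof -
  define \<phi> where "\<phi> s = 1 - pmf (P s x) x" for s
  have sub: "\<phi> (s + r) \<le> \<phi> s + \<phi> r" if "0 \<le> s" "0 \<le> r" for s r
  proof -
    have "pmf (P (s + r) x) x = measure_pmf.expectation (P s x) (\<lambda>y. pmf (P r y) x)"
      using P x that by (simp add: markov_transition_function_def pmf_bind)
    also have "\<dots> \<ge> measure_pmf.expectation (P s x) (\<lambda>y. pmf (P r x) x * indicator {x} y)"
      by (rule integral_mono, (rule integrable_pmf_bounded[where b=1];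
            auto simp: indicator_def pmf_le_1), (rule integrable_pmf_bounded[where b=1];
            auto simp: indicator_def pmf_le_1), auto simp: indicator_def)
    also have "measure_pmf.expectation (P s x) (\<lambda>y. pmf (P r x) x * indicator {x} y) = pmf (P r x) x * pmf (P s x) x"
      by (simp add: measure_pmf_single)
    finally have 1: "pmf (P (s + r) x) x \<ge> pmf (P r x) x * pmf (P s x) x" .
    \<comment> \<open>With \<open>a\<close> and \<open>b\<close> for the two probabilities of being
      at \<open>x\<close>, expanding this product gives
      \<open>1 - a * b \<le> (1 - a) + (1 - b)\<close>.\<close>
    have "0 \<le> (1 - pmf (P r x) x) * (1 - pmf (P s x) x)"
      by (intro mult_nonneg_nonneg) (auto simp: pmf_le_1)
    with 1 show ?thesis unfolding \<phi>_def by (simp add: algebra_simps)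
  qed
  have \<phi>0: "\<phi> 0 = 0" using P x by (simp add: \<phi>_def markov_transition_function_def)
  have mult: "\<phi> (real n * s) \<le> real n * \<phi> s" if "0 \<le> s" for n s
  proof (induction n)
    case 0 then show ?case using \<phi>0 by simp
  next
    case (Suc n)
    have "\<phi> (real (Suc n) * s) = \<phi> (real n * s + s)" by (simp add: algebra_simps)
    also have "\<dots> \<le> \<phi> (real n * s) + \<phi> s" using that by (intro sub) auto
    finally show ?case using Suc by (simp add: algebra_simps)
  qed
  have "((\<lambda>s. pmf (P s x) x) has_real_derivative Q x x) (at 0 within {0..})"
    using P x by (simp add: markov_transition_function_def)
  then have "(\<phi> has_real_derivative - Q x x) (at 0 within {0..})"
    unfolding \<phi>_def by (auto intro!: derivative_eq_intros)
  then have D: "((\<lambda>s. \<phi> s / s) \<longlongrightarrow> - Q x x) (at 0 within {0..})"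
    by (simp add: has_field_derivative_iff \<phi>0)
  show ?thesis
  proof (cases "t = 0")
    case True then show ?thesis using \<phi>0 by (simp add: \<phi>_def)
  next
    case False
    with t have t: "t > 0" by simp
    have "filterlim (\<lambda>n. t / real (Suc n)) (at 0 within {0..}) sequentially"
      using t by (rule filterlim_const_over_Suc)
    from filterlim_compose[OF D this]
    have L: "(\<lambda>n. t * (\<phi> (t / real (Suc n)) / (t / real (Suc n)))) \<longlonglongrightarrow> t * (- Q x x)"
      by (intro tendsto_mult tendsto_const)
    have "\<phi> t \<le> t * (\<phi> (t / real (Suc n)) / (t / real (Suc n)))" for n
    proof -
      have "t * (\<phi> (t / real (Suc n)) / (t / real (Suc n))) = real (Suc n) * \<phi> (t / real (Suc n))"
        using t by simp
      moreover have "real (Suc n) * (t / real (Suc n)) = t" by simp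
      ultimately show ?thesis using mult[of "t / real (Suc n)" "Suc n", OF divide_nonneg_nonneg] t by (simp only: of_nat_0_le_iff less_imp_le)
    qed
    then show ?thesis using L LIMSEQ_le_const unfolding \<phi>_def by blast
  qed
qed

text \<open>Invariance makes the expected difference quotient of \<open>f\<close> vanish for every
  positive time, and dominated convergence lets the time tend to 0. The escape bound provides the
  domination. For the pointwise limit, the derivatives are known one entry at a time only, so
  \<open>A x\<close> is to be a finite set of targets of \<open>x\<close>; the row sum 0 over it
  makes the probability of being elsewhere \<open>o(t)\<close>.\<close>

lemma stationary_distribution_expectation_generator:
  fixes f :: "'x \<Rightarrow> real"
  assumes st: "stationary_distribution \<Omega> Q p"
    and A: "\<And>x. x \<in> \<Omega> \<Longrightarrow> finite (A x)" "\<And>x. x \<in> \<Omega> \<Longrightarrow> A x \<subseteq> \<Omega>" "\<And>x. x \<in> \<Omega> \<Longrightarrow> x \<in> A x"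
    and cons: "\<And>x. x \<in> \<Omega> \<Longrightarrow> (\<Sum>y\<in>A x. Q x y) = 0"
    and q: "\<And>x. x \<in> \<Omega> \<Longrightarrow> - Q x x \<le> q"
    and b: "\<And>x. \<bar>f x\<bar> \<le> b"
  shows "measure_pmf.expectation p (\<lambda>x. \<Sum>y\<in>A x. Q x y * f y) = 0"
proof -
  from st obtain P where P: "markov_transition_function \<Omega> Q P"
    and inv: "\<And>t. t \<ge> 0 \<Longrightarrow> bind_pmf p (P t) = p" and sub: "set_pmf p \<subseteq> \<Omega>"
    unfolding stationary_distribution_def by auto
  define h where "h t x = (measure_pmf.expectation (P t x) f - f x) / t" for t x
  define t where "t n = 1 / real (Suc n)" for n
  have t0: "t n > 0" for n by (simp add: t_def)
  have b0: "0 \<le> b" using b[of undefined] by linarith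
  have le: "\<bar>measure_pmf.expectation q f\<bar> \<le> b" for q
    by (rule abs_expectation_pmf_le) (rule b)
  have zero: "measure_pmf.expectation p (h (t n)) = 0" for n
  proof -
    have "measure_pmf.expectation p (h (t n)) =
      (measure_pmf.expectation p (\<lambda>x. measure_pmf.expectation (P (t n) x) f) - measure_pmf.expectation p f) / t n"
      unfolding h_def
      by (subst Bochner_Integration.integral_diff[symmetric])
         (use le b in \<open>auto intro!: integrable_pmf_bounded\<close>)
    also have "measure_pmf.expectation p (\<lambda>x. measure_pmf.expectation (P (t n) x) f)
        = measure_pmf.expectation (bind_pmf p (P (t n))) f"
      using b by (rule expectation_bind_pmf_bounded[symmetric])
    also have "\<dots> = measure_pmf.expectation p f" using inv[of "t n"] t0[of n] by simp
    finally show ?thesis by simp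
  qed
  \<comment> \<open>The value of \<open>f\<close> changes by at most \<open>2 * b\<close>, and only
    if the chain is away from \<open>x\<close> at time \<open>t n\<close>, which has probability at
    most \<open>t n * q\<close>.\<close>
  have bound: "\<bar>h (t n) x\<bar> \<le> 2 * b * q" if "x \<in> \<Omega>" for n x
  proof -
    have esc: "1 - pmf (P (t n) x) x \<le> t n * q"
      using markov_transition_escape_le[OF P that, of "t n"] t0[of n] q[OF that]
      by (smt (verit) mult_left_mono)
    have "\<bar>measure_pmf.expectation (P (t n) x) f - pmf (P (t n) x) x * f x\<bar> \<le> b * (1 - pmf (P (t n) x) x)"
      using expectation_finite_split[of f b "{x}" "P (t n) x"] b by simp
    moreover have "\<bar>pmf (P (t n) x) x * f x - f x\<bar> \<le> b * (1 - pmf (P (t n) x) x)"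
    proof -
      have "pmf (P (t n) x) x * f x - f x = - (f x * (1 - pmf (P (t n) x) x))" by (simp add: algebra_simps)
      then show ?thesis using b[of x] by (auto simp: abs_mult pmf_le_1 intro: mult_right_mono)
    qed
    ultimately have "\<bar>measure_pmf.expectation (P (t n) x) f - f x\<bar> \<le> 2 * (b * (1 - pmf (P (t n) x) x))"
      by linarith
    also have "\<dots> \<le> 2 * (b * (t n * q))" using esc b0 by (intro mult_left_mono) auto
    finally show ?thesis using t0[of n] by (simp add: h_def field_simps)
  qed
  have tt: "filterlim t (at 0 within {0..}) sequentially"
    unfolding t_def by (rule filterlim_const_over_Suc) simp
  have lim: "(\<lambda>n. h (t n) x) \<longlonglongrightarrow> (\<Sum>y\<in>A x. Q x y * f y)" if x: "x \<in> \<Omega>" for x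
  proof -
    define D where "D n y = (pmf (P (t n) x) y - of_bool (y = x)) / t n" for n y
    have D: "(\<lambda>n. D n y) \<longlonglongrightarrow> Q x y" if y: "y \<in> A x" for y
    proof -
      have "((\<lambda>s. pmf (P s x) y) has_real_derivative Q x y) (at 0 within {0..})"
        using P x subsetD[OF A(2)[OF x] y] by (simp add: markov_transition_function_def)
      then have lim0: "((\<lambda>s. (pmf (P s x) y - pmf (P 0 x) y) / (s - 0)) \<longlongrightarrow> Q x y) (at 0 within {0..})"
        by (simp add: has_field_derivative_iff)
      have ret: "pmf (P 0 x) y = of_bool (y = x)"
        using P x by (auto simp: markov_transition_function_def split: split_indicator)
      from filterlim_compose[OF lim0 tt] show ?thesis
        by (simp add: D_def ret)
    qed
    have fx: "(\<Sum>y\<in>A x. of_bool (y = x) * f y) = f x"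
    proof -
      have "(\<Sum>y\<in>A x. of_bool (y = x) * f y) = (\<Sum>y\<in>A x. if y = x then f y else 0)"
        by (intro sum.cong) auto
      then show ?thesis using A(1,3)[OF x] by simp
    qed
    have f1: "(\<Sum>y\<in>A x. of_bool (y = x)) = (1::real)"
      using A(1,3)[OF x] by (simp add: of_bool_def)
    have eq1: "h (t n) x - (\<Sum>y\<in>A x. D n y * f y) =
        (measure_pmf.expectation (P (t n) x) f - (\<Sum>y\<in>A x. pmf (P (t n) x) y * f y)) / t n" for n
    proof -
      have "(\<Sum>y\<in>A x. D n y * f y) = ((\<Sum>y\<in>A x. pmf (P (t n) x) y * f y) - f x) / t n"
        unfolding fx[symmetric] D_def sum_subtractf[symmetric] sum_divide_distrib
        by (intro sum.cong) (auto simp: field_simps)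
      then show ?thesis by (simp add: h_def diff_divide_distrib)
    qed
    \<comment> \<open>The mass outside \<open>A x\<close>, divided by \<open>t n\<close>, is minus a
      finite sum of difference quotients, so its limit is minus the row sum of \<open>Q\<close>,
      which is 0.\<close>
    have eq2: "(1 - (\<Sum>y\<in>A x. pmf (P (t n) x) y)) / t n = - (\<Sum>y\<in>A x. D n y)" for n
      unfolding f1[symmetric] D_def sum_subtractf sum_divide_distrib[symmetric] minus_divide_left
      by simp
    have dom: "\<bar>h (t n) x - (\<Sum>y\<in>A x. D n y * f y)\<bar> \<le> b * (- (\<Sum>y\<in>A x. D n y))" for n
      using divide_right_mono[OF expectation_finite_split[OF b A(1)[OF x], of "P (t n) x"], of "t n"] t0[of n] b
      unfolding eq1 eq2[symmetric] by (simp add: abs_divide)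
    have "(\<lambda>n. b * (- (\<Sum>y\<in>A x. D n y))) \<longlonglongrightarrow> b * (- (\<Sum>y\<in>A x. Q x y))"
      by (intro tendsto_intros D)
    then have "(\<lambda>n. b * (- (\<Sum>y\<in>A x. D n y))) \<longlonglongrightarrow> 0"
      by (simp only: cons[OF x] minus_zero mult_zero_right)
    then have 0: "(\<lambda>n. h (t n) x - (\<Sum>y\<in>A x. D n y * f y)) \<longlonglongrightarrow> 0"
      by (rule Lim_null_comparison[rotated]) (simp only: real_norm_def dom eventually_True)
    have "(\<lambda>n. \<Sum>y\<in>A x. D n y * f y) \<longlonglongrightarrow> (\<Sum>y\<in>A x. Q x y * f y)"
      by (intro tendsto_intros D)
    from tendsto_add[OF 0 this] show ?thesis by simp
  qed
  have "(\<lambda>n. measure_pmf.expectation p (h (t n))) \<longlonglongrightarrow> measure_pmf.expectation p (\<lambda>x. \<Sum>y\<in>A x. Q x y * f y)"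
    by (rule tendsto_pmf_expectation_bounded[where b="2 * b * q"]) (use sub bound lim in auto)
  then show ?thesis unfolding zero using LIMSEQ_unique tendsto_const by blast
qed

section \<open>Load balancing operators and uniqueness of the invariant law\<close>

text \<open>The generator acting on a test function: summing
  \<open>load_balancing_generator D S E lam mu x y * f y\<close> over \<open>y\<close> turns each
  \<open>jump x z\<close> into \<open>f z - f x\<close>. In this form no set of target states has to
  be named.\<close>

definition load_balancing_operator ::
    "'d set \<Rightarrow> 's set \<Rightarrow> ('d \<times> 's) set \<Rightarrow> ('d \<Rightarrow> real) \<Rightarrow> ('s \<Rightarrow> real)
      \<Rightarrow> (('s \<Rightarrow> nat) \<Rightarrow> real) \<Rightarrow> ('s \<Rightarrow> nat) \<Rightarrow> real" where
  "load_balancing_operator D S E lam mu f x =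
     (\<Sum>d\<in>D. \<Sum>u\<in>least_loaded E x d.
        lam d / real (card (least_loaded E x d)) * (f (x(u := x u + 1)) - f x)) +
     (\<Sum>u\<in>{u\<in>S. 0 < x u}. mu u * (f (x(u := x u - 1)) - f x))"

text \<open>Stationarity in weak form. The bound on \<open>f\<close> is required at all functions,
  not just on \<open>nat_vectors S\<close>, so that bounds on the operator hold at every
  \<open>x\<close> without side conditions.\<close>

definition load_balancing_invariant ::
    "'d set \<Rightarrow> 's set \<Rightarrow> ('d \<times> 's) set \<Rightarrow> ('d \<Rightarrow> real) \<Rightarrow> ('s \<Rightarrow> real)
      \<Rightarrow> ('s \<Rightarrow> nat) pmf \<Rightarrow> bool" where
  "load_balancing_invariant D S E lam mu p \<longleftrightarrow> set_pmf p \<subseteq> nat_vectors S \<and>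
     (\<forall>f b. (\<forall>x. \<bar>f x\<bar> \<le> b) \<longrightarrow>
        measure_pmf.expectation p (load_balancing_operator D S E lam mu f) = 0)"

lemma load_balancing_invariantD:
  assumes "load_balancing_invariant D S E lam mu p" "\<And>x. \<bar>f x\<bar> \<le> b"
  shows "measure_pmf.expectation p (load_balancing_operator D S E lam mu f) = 0"
  using assms unfolding load_balancing_invariant_def by blast

text \<open>The weights add up to \<open>l\<close>, or to 0 if \<open>U\<close> is empty or
  infinite; \<open>0 \<le> b\<close> and \<open>0 \<le> l\<close> cover the second case.\<close>

lemma sum_uniform_weight_le:
  fixes g :: "'a \<Rightarrow> real"
  assumes "\<And>u. u \<in> U \<Longrightarrow> g u \<le> b" "0 \<le> b" "0 \<le> l"
  shows "(\<Sum>u\<in>U. l / real (card U) * g u) \<le> l * b"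
proof (cases "finite U \<and> U \<noteq> {}")
  case True
  have "(\<Sum>u\<in>U. l / real (card U) * g u) \<le> (\<Sum>u\<in>U. l / real (card U) * b)"
    using assms by (intro sum_mono mult_left_mono) auto
  also have "\<dots> = l * b" using True by simp
  finally show ?thesis .
qed (use assms in auto)

lemma abs_sum_uniform_weight_le:
  fixes g :: "'a \<Rightarrow> real"
  assumes "\<And>u. u \<in> U \<Longrightarrow> \<bar>g u\<bar> \<le> b" "0 \<le> b" "0 \<le> l"
  shows "\<bar>\<Sum>u\<in>U. l / real (card U) * g u\<bar> \<le> l * b"
proof -
  have "\<bar>\<Sum>u\<in>U. l / real (card U) * g u\<bar> \<le> (\<Sum>u\<in>U. \<bar>l / real (card U) * g u\<bar>)" by (rule sum_abs)
  also have "\<dots> = (\<Sum>u\<in>U. l / real (card U) * \<bar>g u\<bar>)" using assms by (simp add: abs_mult)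
  also have "\<dots> \<le> l * b" using assms by (intro sum_uniform_weight_le) auto
  finally show ?thesis .
qed

text \<open>Uniqueness will rest on services alone, hence strictly positive service rates next to
  merely nonnegative arrival rates.\<close>

locale load_balancing =
  fixes D :: "'d set" and S :: "'s set" and E :: "('d \<times> 's) set"
    and lam :: "'d \<Rightarrow> real" and mu :: "'s \<Rightarrow> real"
  assumes finite_D: "finite D" and finite_S: "finite S" and E_subset: "E \<subseteq> D \<times> S"
    and lam_nonneg: "\<And>d. d \<in> D \<Longrightarrow> 0 \<le> lam d" and mu_pos: "\<And>u. u \<in> S \<Longrightarrow> 0 < mu u"
begin

abbreviation "L \<equiv> load_balancing_operator D S E lam mu"

definition "total_rate = sum lam D + sum mu S"

lemma least_loaded_subset: "least_loaded E x d \<subseteq> S"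
  using E_subset by (auto simp: least_loaded_def)

lemma finite_least_loaded: "finite (least_loaded E x d)"
  using least_loaded_subset finite_S finite_subset by blast

text \<open>A transition changes \<open>f\<close> by at most \<open>2 * b\<close>, and the rate of
  all transitions out of a state is at most \<open>total_rate\<close>, because each server works at
  rate \<open>mu u\<close> whatever its load.\<close>

lemma operator_abs_le:
  assumes "\<And>x. \<bar>f x\<bar> \<le> b"
  shows "\<bar>L f x\<bar> \<le> 2 * b * total_rate"
proof -
  have b0: "0 \<le> b" using assms[of undefined] by linarith
  have 2: "\<bar>f y - f x\<bar> \<le> 2 * b" for x y using assms[of x] assms[of y] by linarith
  have "\<bar>\<Sum>d\<in>D. \<Sum>u\<in>least_loaded E x d.
        lam d / real (card (least_loaded E x d)) * (f (x(u := x u + 1)) - f x)\<bar>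
     \<le> (\<Sum>d\<in>D. \<bar>\<Sum>u\<in>least_loaded E x d.
        lam d / real (card (least_loaded E x d)) * (f (x(u := x u + 1)) - f x)\<bar>)"
    by (rule sum_abs)
  also have "\<dots> \<le> (\<Sum>d\<in>D. lam d * (2 * b))"
    using 2 lam_nonneg b0 by (intro sum_mono abs_sum_uniform_weight_le) auto
  finally have 3: "\<bar>\<Sum>d\<in>D. \<Sum>u\<in>least_loaded E x d.
        lam d / real (card (least_loaded E x d)) * (f (x(u := x u + 1)) - f x)\<bar> \<le> 2 * b * sum lam D"
    by (simp add: sum_distrib_left sum_distrib_right mult_ac)
  have "\<bar>\<Sum>u\<in>{u\<in>S. 0 < x u}. mu u * (f (x(u := x u - 1)) - f x)\<bar>
      \<le> (\<Sum>u\<in>{u\<in>S. 0 < x u}. \<bar>mu u * (f (x(u := x u - 1)) - f x)\<bar>)" by (rule sum_abs)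
  also have "\<dots> \<le> (\<Sum>u\<in>{u\<in>S. 0 < x u}. mu u * (2 * b))"
    using 2 mu_pos by (intro sum_mono) (auto simp: abs_mult less_imp_le intro!: mult_mono)
  also have "\<dots> \<le> (\<Sum>u\<in>S. mu u * (2 * b))"
    using finite_S mu_pos b0 by (intro sum_mono2) (auto simp: less_imp_le)
  finally have "\<bar>\<Sum>u\<in>{u\<in>S. 0 < x u}. mu u * (f (x(u := x u - 1)) - f x)\<bar> \<le> 2 * b * sum mu S"
    by (simp add: sum_distrib_left sum_distrib_right mult_ac)
  with 3 show ?thesis
    unfolding load_balancing_operator_def total_rate_def ring_distribs by linarith
qed

lemma integrable_operator:
  assumes "\<And>x. \<bar>f x\<bar> \<le> b"
  shows "integrable (measure_pmf p) (L f)"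
  by (rule integrable_pmf_bounded[OF operator_abs_le[OF assms]])

lemma stationary_distribution_imp_invariant:
  assumes st: "stationary_distribution (nat_vectors S) (load_balancing_generator D S E lam mu) p"
  shows "load_balancing_invariant D S E lam mu p"
  unfolding load_balancing_invariant_def
proof (intro conjI allI impI)
  show "set_pmf p \<subseteq> nat_vectors S" using st by (simp add: stationary_distribution_def)
  let ?Q = "load_balancing_generator D S E lam mu"
  \<comment> \<open>The state and its neighbours. A server with \<open>x u = 0\<close> contributes
    \<open>x\<close> itself to the second image, since subtraction on \<open>nat\<close>
    truncates.\<close>
  define A where "A x = insert x ((\<lambda>u. x(u := x u + 1)) ` S \<union> (\<lambda>u. x(u := x u - 1)) ` S)"
    for x :: "'s \<Rightarrow> nat"
  have fin: "finite (A x)" for x using finite_S by (simp add: A_def)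
  have sub: "A x \<subseteq> nat_vectors S" if "x \<in> nat_vectors S" for x
    using that by (auto simp: A_def PiE_def extensional_def)
  have jump: "(\<Sum>y\<in>A x. jump x z y * f y) = f z - f x" if "z \<in> A x" for x z and f :: "('s \<Rightarrow> nat) \<Rightarrow> real"
  proof -
    have "(\<Sum>y\<in>A x. jump x z y * f y) = (\<Sum>y\<in>A x. if y = z then f y else 0) - (\<Sum>y\<in>A x. if y = x then f y else 0)"
      unfolding sum_subtractf[symmetric] by (intro sum.cong) (auto simp: jump_def)
    also have "\<dots> = f z - f x" using fin that by (simp add: A_def)
    finally show ?thesis .
  qed
  have Lf: "(\<Sum>y\<in>A x. ?Q x y * f y) = L f x" for x f
  proof -
    have "(\<Sum>y\<in>A x. ?Q x y * f y) =
      (\<Sum>y\<in>A x. \<Sum>d\<in>D. \<Sum>u\<in>least_loaded E x d.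
        lam d / real (card (least_loaded E x d)) * (jump x (x(u := x u + 1)) y * f y)) +
      (\<Sum>y\<in>A x. \<Sum>u\<in>{u\<in>S. 0 < x u}. mu u * (jump x (x(u := x u - 1)) y * f y))"
      unfolding load_balancing_generator_def sum.distrib[symmetric]
      by (simp only: distrib_right sum_distrib_right mult.assoc)
    also have "\<dots> = (\<Sum>d\<in>D. \<Sum>u\<in>least_loaded E x d.
        lam d / real (card (least_loaded E x d)) * (\<Sum>y\<in>A x. jump x (x(u := x u + 1)) y * f y)) +
      (\<Sum>u\<in>{u\<in>S. 0 < x u}. mu u * (\<Sum>y\<in>A x. jump x (x(u := x u - 1)) y * f y))"
      unfolding sum.swap[of _ _ "A x"] sum_distrib_left ..
    also have "\<dots> = L f x"
      unfolding load_balancing_operator_def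
      by (intro arg_cong2[of _ _ _ _ "(+)"] sum.cong refl arg_cong2[of _ _ _ _ "(*)"] jump)
         (use least_loaded_subset in \<open>auto simp: A_def\<close>)
    finally show ?thesis .
  qed
  have diag: "- ?Q x x \<le> 2 * 1 * total_rate" for x
  proof -
    \<comment> \<open>The diagonal entry is the operator applied to the indicator of
      \<open>x\<close>, so the general bound on the operator also bounds the exit rate.\<close>
    have "?Q x x = (\<Sum>y\<in>A x. ?Q x y * of_bool (y = x))"
      using fin[of x] by (subst sum.mono_neutral_right[of "A x" "{x}"]) (auto simp: A_def)
    also have "\<dots> = L (\<lambda>y. of_bool (y = x)) x" by (rule Lf)
    finally show ?thesis using operator_abs_le[of "\<lambda>y. of_bool (y = x)" 1 x] by simp
  qed
  fix f :: "('s \<Rightarrow> nat) \<Rightarrow> real" and b assume b: "\<forall>x. \<bar>f x\<bar> \<le> b"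
  have "measure_pmf.expectation p (\<lambda>x. \<Sum>y\<in>A x. ?Q x y * f y) = 0"
  proof (rule stationary_distribution_expectation_generator[OF st])
    fix x assume x: "x \<in> nat_vectors S"
    show "(\<Sum>y\<in>A x. ?Q x y) = 0"
      using Lf[of x "\<lambda>_. 1"] by (simp add: load_balancing_operator_def)
  qed (use fin sub diag b in \<open>auto simp: A_def\<close>)
  then show "measure_pmf.expectation p (L f) = 0" unfolding Lf .
qed

text \<open>Testing both invariance identities with the indicator \<open>f\<close> of \<open>{pmf q < pmf p}\<close> makes the sum of
  \<open>(pmf q - pmf p) * L f\<close> vanish. As \<open>L f\<close> is nonpositive on that set and nonnegative off it, all
  summands are nonnegative, hence zero, and no transition leaves the set.\<close>
lemma invariant_superlevel_closed:
  assumes p: "load_balancing_invariant D S E lam mu p"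
    and q: "load_balancing_invariant D S E lam mu q"
    and x: "pmf q x < pmf p x" and u: "u \<in> S" "0 < x u"
  shows "pmf q (x(u := x u - 1)) < pmf p (x(u := x u - 1))"
proof -
  define f where "f y = (of_bool (pmf q y < pmf p y) :: real)" for y
  have f1: "\<bar>f y\<bar> \<le> 1" for y by (simp add: f_def)
  \<comment> \<open>Expectations become integrals against counting measure, where the signed
    difference of the two laws can be integrated.\<close>
  have int: "integrable (count_space UNIV) (\<lambda>y. pmf r y * L f y)"
    and eq: "measure_pmf.expectation r (L f) = (\<integral>y. pmf r y * L f y \<partial>count_space UNIV)" for r
    using integrable_operator[of f 1 r, OF f1]
    by (simp_all add: measure_pmf_eq_density integrable_density integral_density)
  define g where "g y = (pmf q y - pmf p y) * L f y" for y
  have ing: "integrable (count_space UNIV) g"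
    using Bochner_Integration.integrable_diff[OF int[of q] int[of p]]
    unfolding g_def left_diff_distrib .
  have "(\<integral>y. g y \<partial>count_space UNIV) = measure_pmf.expectation q (L f) - measure_pmf.expectation p (L f)"
    unfolding eq g_def left_diff_distrib by (rule Bochner_Integration.integral_diff[OF int int])
  also have "\<dots> = 0"
    using load_balancing_invariantD[OF p f1] load_balancing_invariantD[OF q f1] by simp
  finally have g0: "(\<integral>y. g y \<partial>count_space UNIV) = 0" .
  define a where "a y = (\<Sum>d\<in>D. \<Sum>u\<in>least_loaded E y d.
        lam d / real (card (least_loaded E y d)) * (f (y(u := y u + 1)) - f y))" for y
  define c where "c y = (\<Sum>u\<in>{u\<in>S. 0 < y u}. mu u * (f (y(u := y u - 1)) - f y))" for y
  have L: "L f y = a y + c y" for y by (simp add: load_balancing_operator_def a_def c_def)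
  have w: "0 \<le> lam d / real (card (least_loaded E y d))" if "d \<in> D" for d y
    using lam_nonneg[OF that] by simp
  have m: "0 \<le> mu u" if "u \<in> S" for u using mu_pos[OF that] by simp
  have neg: "a y \<le> 0" "c y \<le> 0" if "pmf q y < pmf p y" for y
  proof -
    have f: "f z - f y \<le> 0" for z using that by (simp add: f_def)
    show "a y \<le> 0" unfolding a_def by (intro sum_nonpos mult_nonneg_nonpos f w)
    show "c y \<le> 0" unfolding c_def by (intro sum_nonpos mult_nonneg_nonpos f m) simp
  qed
  have pos: "a y \<ge> 0" "c y \<ge> 0" if "\<not> pmf q y < pmf p y" for y
  proof -
    have f: "0 \<le> f z - f y" for z using that by (simp add: f_def)
    show "a y \<ge> 0" unfolding a_def by (intro sum_nonneg mult_nonneg_nonneg f w)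
    show "c y \<ge> 0" unfolding c_def by (intro sum_nonneg mult_nonneg_nonneg f m) simp
  qed
  have gpos: "0 \<le> g y" for y
    using neg[of y] pos[of y] unfolding g_def L
    by (cases "pmf q y < pmf p y") (auto intro: mult_nonneg_nonneg mult_nonpos_nonpos)
  have "AE y in count_space UNIV. g y = 0"
    using integral_nonneg_eq_0_iff_AE[OF ing] gpos g0 by simp
  then have "g x = 0" by (simp add: AE_count_space)
  then have "L f x = 0" using x by (simp add: g_def)
  \<comment> \<open>Both parts of \<open>L f x\<close> are nonpositive here, so both vanish. The
    service part is the one whose rates are strictly positive, and it yields the departures.\<close>
  then have "c x = 0" using neg[OF x] L[of x] by linarith
  then have "(\<Sum>u\<in>{u\<in>S. 0 < x u}. - (mu u * (f (x(u := x u - 1)) - f x))) = 0"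
    by (simp only: c_def sum_negf neg_equal_0_iff_equal)
  moreover have "0 \<le> - (mu u * (f (x(u := x u - 1)) - f x))" if "u \<in> S" for u
    using x mu_pos[OF that] by (auto simp: f_def)
  ultimately have "\<forall>u\<in>{u\<in>S. 0 < x u}. - (mu u * (f (x(u := x u - 1)) - f x)) = 0"
    using finite_S by (subst (asm) sum_nonneg_eq_0_iff) auto
  then have "- (mu u * (f (x(u := x u - 1)) - f x)) = 0" using u by blast
  then have "f (x(u := x u - 1)) = 1" using mu_pos[OF u(1)] x by (simp add: f_def)
  then show ?thesis by (simp add: f_def split: if_splits)
qed

text \<open>A departure keeps the state in the superlevel set and lowers the total number of tasks,
  so induction on this total ends in the empty state. Positive mass under \<open>p\<close> forces a
  state of the set to be extensional, hence equal to \<open>\<lambda>u\<in>S. 0\<close> once no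
  tasks are left.\<close>

lemma invariant_superlevel_empty_state:
  assumes p: "load_balancing_invariant D S E lam mu p"
    and q: "load_balancing_invariant D S E lam mu q"
    and x: "pmf q x < pmf p x"
  shows "pmf q (\<lambda>u\<in>S. 0) < pmf p (\<lambda>u\<in>S. 0)"
  using x
proof (induction "\<Sum>u\<in>S. x u" arbitrary: x rule: less_induct)
  case less
  have xS: "x \<in> nat_vectors S"
  proof -
    have "pmf p x \<noteq> 0" using less.prems pmf_nonneg[of q x] by linarith
    then show ?thesis using p by (auto simp: load_balancing_invariant_def set_pmf_iff)
  qed
  show ?case
  proof (cases "\<exists>u\<in>S. 0 < x u")
    case True
    then obtain u where u: "u \<in> S" "0 < x u" by auto
    have "(\<Sum>v\<in>S. (x(u := x u - 1)) v) < (\<Sum>v\<in>S. x v)"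
      using u finite_S by (intro sum_strict_mono_ex1) auto
    then show ?thesis
      using less.hyps invariant_superlevel_closed[OF p q less.prems u] by blast
  next
    case False
    then have "x = (\<lambda>u\<in>S. 0)" using xS by (auto simp: PiE_def extensional_def fun_eq_iff)
    then show ?thesis using less.prems by simp
  qed
qed

text \<open>As both laws have mass 1, distinct laws exceed each other somewhere. Both strict
  inequalities then propagate to the empty state, where they contradict one another.\<close>

lemma invariant_unique:
  assumes p: "load_balancing_invariant D S E lam mu p"
    and q: "load_balancing_invariant D S E lam mu q"
  shows "p = q"
proof (rule ccontr)
  assume ne: "p \<noteq> q"
  have "\<exists>x. pmf q x < pmf p x"
    if "p \<noteq> q" for p q :: "('s \<Rightarrow> nat) pmf"
  proof (rule ccontr)
    assume "\<nexists>x. pmf q x < pmf p x"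
    then have le: "pmf p x \<le> pmf q x" for x by (auto simp: not_less)
    have "pmf p x = pmf q x" for x
    proof -
      have "measure_pmf.prob p (-{x}) \<le> measure_pmf.prob q (-{x})"
        unfolding integral_pmf[symmetric] by (intro integral_mono integrable_pmf le)
      then have "pmf q x \<le> pmf p x"
        using measure_pmf.prob_compl[of "{x}" p] measure_pmf.prob_compl[of "{x}" q]
        by (simp add: Compl_eq_Diff_UNIV measure_pmf_single)
      with le show ?thesis by (simp add: order_antisym)
    qed
    then show False using that pmf_eqI by blast
  qed
  from this[OF ne] this[OF ne[symmetric]] show False
    using invariant_superlevel_empty_state[OF p q] invariant_superlevel_empty_state[OF q p] by force
qed

end

section \<open>The dandelion network\<close>

context load_balancing
begin

text \<open>An automorphism commutes with the operator, \<open>L f (x \<circ> \<sigma>) = L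
  (\<lambda>y. f (y \<circ> \<sigma>)) x\<close>, so the relabelled law is invariant as well and
  uniqueness applies. With involutions, \<open>\<sigma>\<close> and \<open>\<tau>\<close> are their
  own witnesses in every reindexing of a sum.\<close>

lemma invariant_symmetric:
  assumes p: "load_balancing_invariant D S E lam mu p"
    and \<sigma>: "\<And>u. \<sigma> (\<sigma> u) = u" "\<And>u. u \<in> S \<Longrightarrow> \<sigma> u \<in> S"
    and \<tau>: "\<And>d. \<tau> (\<tau> d) = d" "\<And>d. d \<in> D \<Longrightarrow> \<tau> d \<in> D"
    and edges: "\<And>d u. (\<tau> d, \<sigma> u) \<in> E \<longleftrightarrow> (d, u) \<in> E"
    and rates: "\<And>d. lam (\<tau> d) = lam d" "\<And>u. mu (\<sigma> u) = mu u"
  shows "map_pmf (\<lambda>x. x \<circ> \<sigma>) p = p"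
proof (rule invariant_unique[OF _ p], unfold load_balancing_invariant_def, intro conjI allI impI)
  show "set_pmf (map_pmf (\<lambda>x. x \<circ> \<sigma>) p) \<subseteq> nat_vectors S"
  proof -
    have "x \<circ> \<sigma> \<in> nat_vectors S" if "x \<in> nat_vectors S" for x
    proof -
      have "\<sigma> u \<notin> S" if "u \<notin> S" for u using \<sigma>(2)[of "\<sigma> u"] \<sigma>(1)[of u] that by auto
      then show ?thesis using that by (auto simp: PiE_iff extensional_def)
    qed
    then show ?thesis using p by (auto simp: load_balancing_invariant_def)
  qed
  fix f :: "('s \<Rightarrow> nat) \<Rightarrow> real" and b assume b: "\<forall>x. \<bar>f x\<bar> \<le> b"
  have upd: "(x \<circ> \<sigma>)(\<sigma> u := a) = x(u := a) \<circ> \<sigma>" for x :: "'s \<Rightarrow> nat" and u a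
  proof
    fix v
    have "v = \<sigma> u \<longleftrightarrow> \<sigma> v = u" using \<sigma>(1)[of u] \<sigma>(1)[of v] by auto
    then show "((x \<circ> \<sigma>)(\<sigma> u := a)) v = (x(u := a) \<circ> \<sigma>) v" by simp
  qed
  have ll: "u \<in> least_loaded E (x \<circ> \<sigma>) d \<longleftrightarrow> \<sigma> u \<in> least_loaded E x (\<tau> d)" for u x d
  proof -
    have "(\<forall>v. (\<tau> d, v) \<in> E \<longrightarrow> x (\<sigma> u) \<le> x v) \<longleftrightarrow> (\<forall>v. (\<tau> d, \<sigma> v) \<in> E \<longrightarrow> x (\<sigma> u) \<le> x (\<sigma> v))"
      using \<sigma>(1) by metis
    then show ?thesis by (simp add: least_loaded_def edges)
  qed
  have cardll: "card (least_loaded E (x \<circ> \<sigma>) d) = card (least_loaded E x (\<tau> d))" for x d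
    by (rule bij_betw_same_card[of \<sigma>], rule bij_betw_byWitness[of _ \<sigma>]) (use \<sigma>(1) ll in auto)
  have "L f (x \<circ> \<sigma>) = L (\<lambda>y. f (y \<circ> \<sigma>)) x" for x
  proof -
    have "(\<Sum>d\<in>D. \<Sum>u\<in>least_loaded E (x \<circ> \<sigma>) d.
        lam d / real (card (least_loaded E (x \<circ> \<sigma>) d)) * (f ((x \<circ> \<sigma>)(u := (x \<circ> \<sigma>) u + 1)) - f (x \<circ> \<sigma>)))
      = (\<Sum>d\<in>D. \<Sum>u\<in>least_loaded E x (\<tau> d).
        lam (\<tau> d) / real (card (least_loaded E x (\<tau> d))) * (f (x(u := x u + 1) \<circ> \<sigma>) - f (x \<circ> \<sigma>)))"
    proof (rule sum.cong[OF refl])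
      fix d assume "d \<in> D"
      show "(\<Sum>u\<in>least_loaded E (x \<circ> \<sigma>) d.
          lam d / real (card (least_loaded E (x \<circ> \<sigma>) d)) * (f ((x \<circ> \<sigma>)(u := (x \<circ> \<sigma>) u + 1)) - f (x \<circ> \<sigma>)))
        = (\<Sum>u\<in>least_loaded E x (\<tau> d).
          lam (\<tau> d) / real (card (least_loaded E x (\<tau> d))) * (f (x(u := x u + 1) \<circ> \<sigma>) - f (x \<circ> \<sigma>)))"
        by (rule sum.reindex_bij_witness[of _ \<sigma> \<sigma>])
           (use \<sigma>(1) ll rates upd[of x "\<sigma> _"] in \<open>auto simp: cardll\<close>)
    qed
    also have "\<dots> = (\<Sum>d\<in>D. \<Sum>u\<in>least_loaded E x d.
        lam d / real (card (least_loaded E x d)) * (f (x(u := x u + 1) \<circ> \<sigma>) - f (x \<circ> \<sigma>)))"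
      by (rule sum.reindex_bij_witness[of _ \<tau> \<tau>]) (use \<tau> in auto)
    finally have 1: "(\<Sum>d\<in>D. \<Sum>u\<in>least_loaded E (x \<circ> \<sigma>) d.
        lam d / real (card (least_loaded E (x \<circ> \<sigma>) d)) * (f ((x \<circ> \<sigma>)(u := (x \<circ> \<sigma>) u + 1)) - f (x \<circ> \<sigma>)))
      = \<dots>" .
    have 2: "(\<Sum>u\<in>{u\<in>S. 0 < (x \<circ> \<sigma>) u}. mu u * (f ((x \<circ> \<sigma>)(u := (x \<circ> \<sigma>) u - 1)) - f (x \<circ> \<sigma>)))
      = (\<Sum>u\<in>{u\<in>S. 0 < x u}. mu u * (f (x(u := x u - 1) \<circ> \<sigma>) - f (x \<circ> \<sigma>)))"
      by (rule sum.reindex_bij_witness[of _ \<sigma> \<sigma>])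
         (use \<sigma> rates upd[of x "\<sigma> _"] in auto)
    show ?thesis unfolding load_balancing_operator_def 1 2 ..
  qed
  then have "measure_pmf.expectation (map_pmf (\<lambda>x. x \<circ> \<sigma>) p) (L f) =
      measure_pmf.expectation p (L (\<lambda>y. f (y \<circ> \<sigma>)))" by simp
  also have "\<dots> = 0" using b by (intro load_balancing_invariantD[OF p]) auto
  finally show "measure_pmf.expectation (map_pmf (\<lambda>x. x \<circ> \<sigma>) p) (L f) = 0" .
qed

end

lemma real_of_nat_le_square: "real k \<le> real k ^ 2"
proof -
  have "k \<le> k\<^sup>2" by (simp add: power2_eq_square)
  then show ?thesis by (metis of_nat_le_iff of_nat_power)
qed

locale dandelion =
  fixes C :: "'s set" and B :: "nat \<Rightarrow> 's set" and lam mu :: real and n :: nat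
    and K :: nat
  assumes finite_C: "finite C"
    and finite_B: "\<And>d. d \<ge> 1 \<Longrightarrow> finite (B d)"
    and card_B: "\<And>d. d \<ge> 1 \<Longrightarrow> card (B d) = K"
    and C_disjoint: "\<And>d. d \<ge> 1 \<Longrightarrow> C \<inter> B d = {}"
    and B_disjoint: "disjoint_family_on B {1..}"
    and lam_pos: "lam > 0" and mu_pos': "mu > 0" and stable: "lam < mu * real K"
begin

abbreviation "S \<equiv> dandelion_servers C B n"
abbreviation "E \<equiv> dandelion_edges C B n"

sublocale load_balancing "{1..n}" S E "\<lambda>_. lam" "\<lambda>_. mu"
  by unfold_locales
     (use finite_C finite_B lam_pos mu_pos' in \<open>auto simp: dandelion_servers_def dandelion_edges_def\<close>)

abbreviation "invariant \<equiv> load_balancing_invariant {1..n} S E (\<lambda>_. lam) (\<lambda>_. mu)"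

text \<open>The conditional probability, given the state \<open>x\<close>, that a task arriving at
  dispatcher \<open>d\<close> of the network is sent to a central server.\<close>

definition central_fraction :: "nat \<Rightarrow> ('s \<Rightarrow> nat) \<Rightarrow> real" where
  "central_fraction d x = real (card (least_loaded E x d \<inter> C)) / real (card (least_loaded E x d))"

lemma K_pos: "K > 0"
  using stable lam_pos mu_pos' by (cases "K = 0") auto

lemma B_eqD: "d \<ge> 1 \<Longrightarrow> e \<ge> 1 \<Longrightarrow> u \<in> B d \<Longrightarrow> u \<in> B e \<Longrightarrow> d = e"
  using B_disjoint by (auto simp: disjoint_family_on_def)

lemma edge_iff: "(d, u) \<in> E \<longleftrightarrow> 1 \<le> d \<and> d \<le> n \<and> (u \<in> B d \<or> u \<in> C)"
  by (auto simp: dandelion_edges_def)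

lemma central_fraction_bounds: "0 \<le> central_fraction d x" "central_fraction d x \<le> 1"
proof -
  have "card (least_loaded E x d \<inter> C) \<le> card (least_loaded E x d)"
    by (intro card_mono finite_least_loaded) auto
  then show "central_fraction d x \<le> 1" by (auto simp: central_fraction_def divide_le_eq)
qed (simp add: central_fraction_def)

text \<open>Exchanging \<open>B d\<close> with \<open>B e\<close> is an automorphism of the network, so by uniqueness it preserves the
  invariant law.\<close>
lemma expectation_central_fraction_eq:
  assumes p: "invariant p" and d: "d \<in> {1..n}" "e \<in> {1..n}"
  shows "measure_pmf.expectation p (central_fraction d) = measure_pmf.expectation p (central_fraction e)"
proof (cases "d = e")
  case False
  have de: "1 \<le> d" "1 \<le> e" using d by auto
  obtain g where g: "bij_betw g (B d) (B e)"
    using finite_same_card_bij[of "B d" "B e"] finite_B card_B de by auto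
  define g' where "g' = inv_into (B d) g"
  have gg: "g' (g u) = u" "g u \<in> B e" if "u \<in> B d" for u
    using g that unfolding g'_def by (auto simp: bij_betw_inv_into_left bij_betwE)
  have gg': "g (g' u) = u" "g' u \<in> B d" if "u \<in> B e" for u
    using g that bij_betw_inv_into[OF g] unfolding g'_def by (auto simp: bij_betw_inv_into_right bij_betwE)
  \<comment> \<open>Pasting a bijection of \<open>B d\<close> onto \<open>B e\<close> with its
    inverse gives an involution of the servers, and \<open>\<tau>\<close> is the matching
    transposition of dispatchers.\<close>
  define \<sigma> where "\<sigma> u = (if u \<in> B d then g u else if u \<in> B e then g' u else u)" for u
  define \<tau> where "\<tau> i = (if i = d then e else if i = e then d else i)" for i :: nat
  have dis: "u \<notin> B e" if "u \<in> B d" for u using B_eqD[OF de that] False by auto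
  have \<sigma>\<sigma>: "\<sigma> (\<sigma> u) = u" for u unfolding \<sigma>_def using gg[of u] gg'[of u] dis[of u] dis[of "g u"] by auto
  have \<tau>\<tau>: "\<tau> (\<tau> i) = i" for i by (auto simp: \<tau>_def)
  have \<tau>n: "1 \<le> \<tau> i \<and> \<tau> i \<le> n \<longleftrightarrow> 1 \<le> i \<and> i \<le> n" for i using d by (auto simp: \<tau>_def)
  have \<sigma>C: "\<sigma> u = u" if "u \<in> C" for u
    using that C_disjoint[of d] C_disjoint[of e] de by (auto simp: \<sigma>_def)
  have \<sigma>C': "\<sigma> u \<in> C \<longleftrightarrow> u \<in> C" for u using \<sigma>C[of u] \<sigma>C[of "\<sigma> u"] \<sigma>\<sigma>[of u] by auto
  have \<sigma>B1: "\<sigma> u \<in> B (\<tau> i)" if "1 \<le> i" "u \<in> B i" for i u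
    using that gg[of u] gg'[of u] dis[of u] B_eqD[of i d u] B_eqD[of i e u] de
    by (auto simp: \<sigma>_def \<tau>_def)
  have \<sigma>B: "\<sigma> u \<in> B (\<tau> i) \<longleftrightarrow> u \<in> B i" if "1 \<le> i" for i u
    using \<sigma>B1[of i u] \<sigma>B1[of "\<tau> i" "\<sigma> u"] that de by (auto simp: \<sigma>\<sigma> \<tau>\<tau>) (auto simp: \<tau>_def split: if_splits)
  have edges: "(\<tau> i, \<sigma> u) \<in> E \<longleftrightarrow> (i, u) \<in> E" for i u
    unfolding edge_iff using \<tau>n[of i] \<sigma>B[of i u] \<sigma>C'[of u] by auto
  have inv: "map_pmf (\<lambda>x. x \<circ> \<sigma>) p = p"
  proof (rule invariant_symmetric[OF p, where \<tau>=\<tau>])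
    fix u assume "u \<in> S"
    then consider "u \<in> C" | i where "1 \<le> i" "i \<le> n" "u \<in> B i"
      by (auto simp: dandelion_servers_def)
    then show "\<sigma> u \<in> S"
    proof cases
      case 1 then show ?thesis using \<sigma>C[of u] by (simp add: dandelion_servers_def)
    next
      case 2 then show ?thesis using \<sigma>B1[of i u] \<tau>n[of i] by (auto simp: dandelion_servers_def)
    qed
  qed (use \<sigma>\<sigma> \<tau>\<tau> \<tau>n edges in auto)
  have ll: "u \<in> least_loaded E (x \<circ> \<sigma>) d \<longleftrightarrow> \<sigma> u \<in> least_loaded E x e" for u x
  proof -
    have \<tau>d: "\<tau> d = e" by (simp add: \<tau>_def)
    have "(\<forall>v. (e, v) \<in> E \<longrightarrow> x (\<sigma> u) \<le> x v) \<longleftrightarrow> (\<forall>v. (e, \<sigma> v) \<in> E \<longrightarrow> x (\<sigma> u) \<le> x (\<sigma> v))"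
      using \<sigma>\<sigma> by metis
    then show ?thesis using edges[of d] by (simp add: least_loaded_def \<tau>d)
  qed
  have c1: "card (least_loaded E (x \<circ> \<sigma>) d) = card (least_loaded E x e)" for x
    by (rule bij_betw_same_card[of \<sigma>], rule bij_betw_byWitness[of _ \<sigma>]) (use \<sigma>\<sigma> ll in auto)
  have c2: "card (least_loaded E (x \<circ> \<sigma>) d \<inter> C) = card (least_loaded E x e \<inter> C)" for x
    by (rule bij_betw_same_card[of \<sigma>], rule bij_betw_byWitness[of _ \<sigma>]) (use \<sigma>\<sigma> ll \<sigma>C' in auto)
  have "measure_pmf.expectation p (central_fraction d)
      = measure_pmf.expectation (map_pmf (\<lambda>x. x \<circ> \<sigma>) p) (central_fraction d)" by (simp only: inv)
  also have "\<dots> = measure_pmf.expectation p (central_fraction e)"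
    unfolding integral_map_pmf central_fraction_def c1 c2 ..
  finally show ?thesis .
qed simp

text \<open>Flow balance for the central servers. The number of central tasks may fail to be integrable a
  priori, hence the truncation of the test function at \<open>k\<close>.\<close>
lemma sum_expectation_central_fraction_le:
  assumes p: "invariant p"
  shows "(\<Sum>d\<in>{1..n}. lam * measure_pmf.expectation p (central_fraction d)) \<le> mu * real (card C)"
proof -
  define X where "X x = (\<Sum>c\<in>C. x c)" for x :: "'s \<Rightarrow> nat"
  define H where "H x = (\<Sum>d\<in>{1..n}. lam * central_fraction d x)" for x
  have H: "0 \<le> H x" "H x \<le> real n * lam" for x
  proof -
    show "0 \<le> H x" unfolding H_def using central_fraction_bounds lam_pos by (intro sum_nonneg) auto
    have "H x \<le> (\<Sum>d\<in>{1..n}. lam * 1)"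
      unfolding H_def using central_fraction_bounds lam_pos by (intro sum_mono mult_left_mono) auto
    then show "H x \<le> real n * lam" by simp
  qed
  have add: "X (x(u := x u + 1)) = X x + of_bool (u \<in> C)" for x u
    unfolding X_def using finite_C by (cases "u \<in> C") (auto simp: sum.remove[of C u] intro!: sum.cong)
  have rem: "X x = X (x(u := x u - 1)) + of_bool (u \<in> C)" if "0 < x u" for x u
    unfolding X_def using finite_C that by (cases "u \<in> C") (auto simp: sum.remove[of C u] intro!: sum.cong)
  have le: "measure_pmf.expectation p (\<lambda>x. of_bool (X x < k) * H x) \<le> mu * real (card C)" for k
  proof -
    define f where "f x = real (min (X x) k)" for x
    have fb: "\<bar>f x\<bar> \<le> real k" for x by (simp add: f_def)
    \<comment> \<open>Tasks enter \<open>C\<close> at rate \<open>H x\<close>, which raises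
      \<open>f\<close> only while \<open>X x < k\<close>; each server of \<open>C\<close> lowers
      \<open>f\<close> by at most 1, at rate at most \<open>mu\<close>.\<close>
    have "of_bool (X x < k) * H x - mu * real (card C) \<le> L f x" for x
    proof -
      have "f (x(u := x u + 1)) - f x = of_bool (X x < k) * of_bool (u \<in> C)" for u
        unfolding f_def add by auto
      then have "(\<Sum>d\<in>{1..n}. \<Sum>u\<in>least_loaded E x d.
          lam / real (card (least_loaded E x d)) * (f (x(u := x u + 1)) - f x))
        = (\<Sum>d\<in>{1..n}. \<Sum>u\<in>least_loaded E x d.
          lam / real (card (least_loaded E x d)) * (of_bool (X x < k) * of_bool (u \<in> C)))" by simp
      also have "\<dots> = (\<Sum>d\<in>{1..n}. lam * central_fraction d x * of_bool (X x < k))"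
      proof (rule sum.cong[OF refl])
        fix d
        have "(\<Sum>u\<in>least_loaded E x d. lam / real (card (least_loaded E x d)) * (of_bool (X x < k) * of_bool (u \<in> C)))
          = lam / real (card (least_loaded E x d)) * of_bool (X x < k) * (\<Sum>u\<in>least_loaded E x d. of_bool (u \<in> C))"
          unfolding sum_distrib_left by (intro sum.cong) simp_all
        also have "(\<Sum>u\<in>least_loaded E x d. of_bool (u \<in> C)) = real (card (least_loaded E x d \<inter> C))"
          using finite_least_loaded[of x d] by (simp add: Int_def)
        finally show "(\<Sum>u\<in>least_loaded E x d. lam / real (card (least_loaded E x d)) * (of_bool (X x < k) * of_bool (u \<in> C)))
          = lam * central_fraction d x * of_bool (X x < k)" by (simp add: central_fraction_def)
      qed
      also have "\<dots> = of_bool (X x < k) * H x" by (simp add: H_def sum_distrib_left mult_ac)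
      finally have 1: "(\<Sum>d\<in>{1..n}. \<Sum>u\<in>least_loaded E x d.
          lam / real (card (least_loaded E x d)) * (f (x(u := x u + 1)) - f x)) = of_bool (X x < k) * H x" .
      have "- of_bool (u \<in> C) \<le> f (x(u := x u - 1)) - f x" if "0 < x u" for u
        using rem[of x u] that unfolding f_def by auto
      then have "(\<Sum>u\<in>{u\<in>S. 0 < x u}. mu * (- of_bool (u \<in> C)))
          \<le> (\<Sum>u\<in>{u\<in>S. 0 < x u}. mu * (f (x(u := x u - 1)) - f x))"
        using mu_pos' by (intro sum_mono mult_left_mono) auto
      moreover have "(\<Sum>u\<in>S. mu * (- of_bool (u \<in> C))) \<le> (\<Sum>u\<in>{u\<in>S. 0 < x u}. mu * (- of_bool (u \<in> C)))"
        using finite_S mu_pos' by (intro sum_mono2[where f="\<lambda>u. - (mu * (- of_bool (u \<in> C)))" and A="{u\<in>S. 0 < x u}" and B=S, unfolded sum_negf neg_le_iff_le]) auto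
      moreover have "(\<Sum>u\<in>S. mu * (- of_bool (u \<in> C))) = - (mu * real (card C))"
      proof -
        have "(\<Sum>u\<in>S. of_bool (u \<in> C)) = real (card (S \<inter> C))" using finite_S by (simp add: Int_def)
        also have "S \<inter> C = C" by (auto simp: dandelion_servers_def)
        finally show ?thesis by (simp add: sum_distrib_left[symmetric] sum_negf)
      qed
      ultimately show ?thesis unfolding load_balancing_operator_def 1 by linarith
    qed
    moreover have int: "integrable (measure_pmf p) (\<lambda>x. of_bool (X x < k) * H x)"
      using H lam_pos by (intro integrable_pmf_bounded[where b="real n * lam"]) auto
    ultimately have "measure_pmf.expectation p (\<lambda>x. of_bool (X x < k) * H x - mu * real (card C)) \<le> measure_pmf.expectation p (L f)"
      by (intro integral_mono integrable_operator[of f, OF fb] Bochner_Integration.integrable_diff) auto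
    also have "\<dots> = 0" by (rule load_balancing_invariantD[OF p fb])
    finally show ?thesis
      by (subst (asm) Bochner_Integration.integral_diff[OF int]) auto
  qed
  \<comment> \<open>The rate \<open>H\<close> is bounded by \<open>n * lam\<close>, in contrast to
    \<open>X\<close>, so dominated convergence removes the truncation.\<close>
  have "(\<lambda>k. measure_pmf.expectation p (\<lambda>x. of_bool (X x < k) * H x)) \<longlonglongrightarrow> measure_pmf.expectation p H"
  proof (rule tendsto_pmf_expectation_bounded[where b="real n * lam"])
    show "(\<lambda>k. of_bool (X x < k) * H x) \<longlonglongrightarrow> H x" for x
      by (rule tendsto_eventually) (use eventually_gt_at_top[of "X x"] in \<open>auto elim: eventually_mono\<close>)
  qed (use H lam_pos in auto)
  then have "measure_pmf.expectation p H \<le> mu * real (card C)"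
    using le LIMSEQ_le_const2 by blast
  also have "measure_pmf.expectation p H = (\<Sum>d\<in>{1..n}. lam * measure_pmf.expectation p (central_fraction d))"
    unfolding H_def
    by (subst Bochner_Integration.integral_sum)
       (use central_fraction_bounds in \<open>auto intro!: integrable_pmf_bounded[where b=1]\<close>)
  finally show ?thesis .
qed

lemma expectation_central_fraction_le:
  assumes p: "invariant p" and d: "d \<in> {1..n}"
  shows "measure_pmf.expectation p (central_fraction d) \<le> mu * real (card C) / (lam * real n)"
proof -
  have "(\<Sum>e\<in>{1..n}. lam * measure_pmf.expectation p (central_fraction e))
      = (\<Sum>e\<in>{1..n}. lam * measure_pmf.expectation p (central_fraction d))"
    using expectation_central_fraction_eq[OF p _ d] by (intro sum.cong) auto
  then have "real n * (lam * measure_pmf.expectation p (central_fraction d)) \<le> mu * real (card C)"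
    using sum_expectation_central_fraction_le[OF p] by simp
  then show ?thesis using d lam_pos by (simp add: field_simps)
qed

text \<open>At most \<open>K + card C\<close> servers are compatible with \<open>d\<close>, so a
  single central server among the least loaded ones already makes the central fraction at least
  \<open>1 / (K + card C)\<close>.\<close>

lemma prob_central_least_loaded_le:
  assumes p: "invariant p" and d: "d \<in> {1..n}"
  shows "measure_pmf.expectation p (\<lambda>x. of_bool (least_loaded E x d \<inter> C \<noteq> {}))
    \<le> real (K + card C) * (mu * real (card C) / (lam * real n))"
proof -
  have "of_bool (least_loaded E x d \<inter> C \<noteq> {}) \<le> real (K + card C) * central_fraction d x" for x
  proof (cases "least_loaded E x d \<inter> C = {}")
    case False
    have sub: "least_loaded E x d \<subseteq> B d \<union> C" by (auto simp: least_loaded_def edge_iff)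
    have "card (least_loaded E x d) \<le> card (B d \<union> C)"
      using finite_B[of d] finite_C d by (intro card_mono sub) auto
    also have "\<dots> \<le> K + card C" using card_Un_le[of "B d" C] card_B[of d] d by simp
    finally have 1: "card (least_loaded E x d) \<le> K + card C" .
    have "0 < card (least_loaded E x d \<inter> C)" "0 < card (least_loaded E x d)"
      using False finite_least_loaded[of x d] by (auto simp: card_gt_0_iff)
    then have "real (card (least_loaded E x d)) \<le> real (K + card C) * real (card (least_loaded E x d \<inter> C))"
      using 1 by (metis One_nat_def Suc_leI le_trans mult.right_neutral mult_le_mono2 of_nat_le_iff of_nat_mult)
    then show ?thesis using False \<open>0 < card (least_loaded E x d)\<close>
      by (simp add: central_fraction_def field_simps)
  qed (simp add: central_fraction_bounds)
  then have "measure_pmf.expectation p (\<lambda>x. of_bool (least_loaded E x d \<inter> C \<noteq> {}))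
      \<le> measure_pmf.expectation p (\<lambda>x. real (K + card C) * central_fraction d x)"
    by (intro integral_mono integrable_mult_right integrable_pmf_bounded[where b=1])
       (use central_fraction_bounds in auto)
  also have "\<dots> \<le> real (K + card C) * (mu * real (card C) / (lam * real n))"
    unfolding Bochner_Integration.integral_mult_right_zero
    by (intro mult_left_mono expectation_central_fraction_le[OF p d]) simp
  finally show ?thesis .
qed


text \<open>Drift of \<open>\<Sum>u\<in>B d. (x u)\<^sup>2\<close>: an arriving task that joins \<open>B d\<close> joins a server whose load is at most
  the average over \<open>B d\<close>, and tasks diverted to \<open>C\<close> only help, so the bound does not depend on \<open>n\<close>.\<close>
lemma expectation_boundary_truncated_le:
  assumes p: "invariant p" and d: "d \<in> {1..n}" and k: "0 \<le> k"
  shows "2 * (mu - lam / real K) * measure_pmf.expectation p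
      (\<lambda>x. of_bool ((\<Sum>u\<in>B d. real (x u) ^ 2) < k) * (\<Sum>u\<in>B d. real (x u))) \<le> lam + mu * real K"
proof -
  have d1: "1 \<le> d" "d \<le> n" using d by auto
  have fin: "finite (B d)" and cd: "card (B d) = K" using finite_B card_B d1 by auto
  define V where "V x = (\<Sum>u\<in>B d. real (x u) ^ 2)" for x :: "'s \<Rightarrow> nat"
  define W where "W x = (\<Sum>u\<in>B d. real (x u))" for x :: "'s \<Rightarrow> nat"
  define f where "f x = min (V x) k" for x
  \<comment> \<open>Below the level \<open>k\<close>, arrivals contribute at most
    \<open>lam * (2 * W x / K + 1)\<close> to the drift and services at most
    \<open>mu * (K - 2 * W x)\<close>; the sum of the two is
    \<open>c - \<delta> * W x\<close>.\<close>
  define c where "c = lam + mu * real K"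
  define \<delta> where "\<delta> = 2 * (mu - lam / real K)"
  have V0: "0 \<le> V x" for x unfolding V_def by (intro sum_nonneg) auto
  have W0: "0 \<le> W x" for x unfolding W_def by (intro sum_nonneg) auto
  \<comment> \<open>Hence the truncation \<open>V x < k\<close> bounds \<open>W x\<close> too, which
    makes the truncated \<open>W\<close> integrable.\<close>
  have WV: "W x \<le> V x" for x
    unfolding V_def W_def by (rule sum_mono) (rule real_of_nat_le_square)
  have fb: "\<bar>f x\<bar> \<le> k" for x using V0[of x] k by (simp add: f_def)
  have V_upd: "V (x(u := a)) = V x + of_bool (u \<in> B d) * (real a ^ 2 - real (x u) ^ 2)" for x u a
    unfolding V_def using fin by (cases "u \<in> B d") (auto simp: sum.remove[of "B d" u] intro!: sum.cong)
  have V_add: "V (x(u := x u + 1)) - V x = of_bool (u \<in> B d) * (2 * real (x u) + 1)" for x u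
    unfolding V_upd by (simp add: power2_eq_square algebra_simps)
  have V_rem: "V (x(u := x u - 1)) - V x = of_bool (u \<in> B d) * (1 - 2 * real (x u))" if "0 < x u" for x u
    unfolding V_upd using that by (simp add: power2_eq_square algebra_simps of_nat_diff)
  have drift: "L f x \<le> of_bool (V x < k) * (c - \<delta> * W x)" for x
  proof (cases "V x < k")
    case False
    have "f y - f x \<le> 0" for y using False by (auto simp: f_def)
    then have "L f x \<le> 0" unfolding load_balancing_operator_def using lam_pos mu_pos'
      by (intro add_nonpos_nonpos sum_nonpos mult_nonneg_nonpos) auto
    then show ?thesis using False by simp
  next
    case True
    \<comment> \<open>Below the level, \<open>f x\<close> is \<open>V x\<close> itself, while
      truncation can only lower the value at \<open>y\<close>.\<close>
    then have inc: "f y - f x \<le> V y - V x" for y by (auto simp: f_def)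
    have arr: "(\<Sum>u\<in>least_loaded E x e. lam / real (card (least_loaded E x e)) * (f (x(u := x u + 1)) - f x))
        \<le> (if e = d then lam * (2 * W x / real K + 1) else 0)" if e: "e \<in> {1..n}" for e
    proof (cases "e = d")
      case False
      have "u \<notin> B d" if "u \<in> least_loaded E x e" for u
        using that e d1 False B_eqD[of e d u] C_disjoint[of d] by (auto simp: least_loaded_def edge_iff)
      then have "f (x(u := x u + 1)) - f x \<le> 0" if "u \<in> least_loaded E x e" for u
        using that inc[of "x(u := x u + 1)"] V_add[of x u] by auto
      then have "(\<Sum>u\<in>least_loaded E x e. lam / real (card (least_loaded E x e)) * (f (x(u := x u + 1)) - f x)) \<le> 0"
        using lam_pos by (intro sum_nonpos mult_nonneg_nonpos) auto
      then show ?thesis using False by simp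
    next
      case True
      have "f (x(u := x u + 1)) - f x \<le> 2 * W x / real K + 1" if u: "u \<in> least_loaded E x d" for u
      proof (cases "u \<in> B d")
        case True
        have "(\<Sum>v\<in>B d. real (x u)) \<le> W x"
          unfolding W_def using u d1 by (intro sum_mono) (auto simp: least_loaded_def edge_iff)
        then have "real (x u) \<le> W x / real K" using K_pos cd by (simp add: field_simps)
        then show ?thesis using inc[of "x(u := x u + 1)"] V_add[of x u] True by simp
      next
        case False
        moreover have "0 \<le> 2 * W x / real K" using W0[of x] by simp
        ultimately show ?thesis using inc[of "x(u := x u + 1)"] V_add[of x u] by simp
      qed
      then have "(\<Sum>u\<in>least_loaded E x d. lam / real (card (least_loaded E x d)) * (f (x(u := x u + 1)) - f x))
          \<le> lam * (2 * W x / real K + 1)"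
        using W0[of x] lam_pos by (intro sum_uniform_weight_le) auto
      then show ?thesis using True by simp
    qed
    have "(\<Sum>e\<in>{1..n}. \<Sum>u\<in>least_loaded E x e. lam / real (card (least_loaded E x e)) * (f (x(u := x u + 1)) - f x))
        \<le> (\<Sum>e\<in>{1..n}. if e = d then lam * (2 * W x / real K + 1) else 0)"
      by (intro sum_mono arr)
    also have "\<dots> = lam * (2 * W x / real K + 1)" using d by simp
    finally have 1: "(\<Sum>e\<in>{1..n}. \<Sum>u\<in>least_loaded E x e. lam / real (card (least_loaded E x e)) * (f (x(u := x u + 1)) - f x))
        \<le> lam * (2 * W x / real K + 1)" .
    have "f (x(u := x u - 1)) - f x \<le> of_bool (u \<in> B d) * (1 - 2 * real (x u))" if "0 < x u" for u
      using inc[of "x(u := x u - 1)"] V_rem[of x u, OF that] by linarith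
    then have "(\<Sum>u\<in>{u\<in>S. 0 < x u}. mu * (f (x(u := x u - 1)) - f x))
        \<le> (\<Sum>u\<in>{u\<in>S. 0 < x u}. mu * (of_bool (u \<in> B d) * (1 - 2 * real (x u))))"
      using mu_pos' by (intro sum_mono mult_left_mono) auto
    \<comment> \<open>An empty server would contribute \<open>mu\<close> or 0, so including the
      empty servers can only increase the sum.\<close>
    also have "\<dots> \<le> (\<Sum>u\<in>S. mu * (of_bool (u \<in> B d) * (1 - 2 * real (x u))))"
      using finite_S mu_pos' by (intro sum_mono2) auto
    also have "\<dots> = (\<Sum>u\<in>B d. mu * (1 - 2 * real (x u)))"
      using finite_S d1 by (intro sum.mono_neutral_cong_right) (auto simp: dandelion_servers_def)
    also have "\<dots> = mu * (real K - 2 * W x)"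
      by (simp add: W_def sum_distrib_left[symmetric] sum_subtractf cd)
    finally have 2: "(\<Sum>u\<in>{u\<in>S. 0 < x u}. mu * (f (x(u := x u - 1)) - f x)) \<le> mu * (real K - 2 * W x)" .
    have "L f x \<le> lam * (2 * W x / real K + 1) + mu * (real K - 2 * W x)"
      unfolding load_balancing_operator_def using 1 2 by linarith
    also have "\<dots> = c - \<delta> * W x" using K_pos by (simp add: c_def \<delta>_def field_simps)
    finally show ?thesis using True by simp
  qed
  have c0: "0 \<le> c" using lam_pos mu_pos' by (simp add: c_def)
  have int: "integrable (measure_pmf p) (\<lambda>x. of_bool (V x < k) * W x)"
    using W0 k order.trans[OF WV] by (intro integrable_pmf_bounded[where b=k]) (auto simp: less_imp_le)
  have int1: "integrable (measure_pmf p) (\<lambda>x. of_bool (V x < k) * c)"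
    using c0 by (intro integrable_pmf_bounded[where b=c]) auto
  have "0 = measure_pmf.expectation p (L f)" using load_balancing_invariantD[OF p fb] by simp
  also have "\<dots> \<le> measure_pmf.expectation p (\<lambda>x. of_bool (V x < k) * c - \<delta> * (of_bool (V x < k) * W x))"
  proof (intro integral_mono integrable_operator[of f, OF fb] Bochner_Integration.integrable_diff int1 integrable_mult_right int)
    show "L f x \<le> of_bool (V x < k) * c - \<delta> * (of_bool (V x < k) * W x)" for x
      using drift[of x] by (auto simp: algebra_simps)
  qed
  also have "\<dots> = measure_pmf.expectation p (\<lambda>x. of_bool (V x < k) * c)
      - \<delta> * measure_pmf.expectation p (\<lambda>x. of_bool (V x < k) * W x)"
    using int1 int by (subst Bochner_Integration.integral_diff) auto
  also have "measure_pmf.expectation p (\<lambda>x. of_bool (V x < k) * c) \<le> c"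
    using abs_expectation_pmf_le[of p "\<lambda>x. of_bool (V x < k) * c" c] c0 by auto
  finally show ?thesis by (simp add: V_def W_def \<delta>_def c_def)
qed

text \<open>Markov's inequality, applied on the event \<open>V x < k\<close> since \<open>W\<close>
  is not known to be integrable beforehand; then \<open>k\<close> tends to infinity. The bound is
  free of \<open>n\<close>, which is what tightness asks for.\<close>

lemma prob_boundary_large_le:
  assumes p: "invariant p" and d: "d \<in> {1..n}" and m: "0 < m"
  shows "measure_pmf.expectation p (\<lambda>x. of_bool (m \<le> (\<Sum>u\<in>B d. real (x u))))
    \<le> (lam + mu * real K) / (2 * (mu - lam / real K) * m)"
proof -
  define V where "V x = (\<Sum>u\<in>B d. real (x u) ^ 2)" for x :: "'s \<Rightarrow> nat"
  define W where "W x = (\<Sum>u\<in>B d. real (x u))" for x :: "'s \<Rightarrow> nat"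
  define c where "c = lam + mu * real K"
  define \<delta> where "\<delta> = 2 * (mu - lam / real K)"
  have \<delta>0: "0 < \<delta>" using stable K_pos by (simp add: \<delta>_def field_simps)
  have W0: "0 \<le> W x" for x unfolding W_def by (intro sum_nonneg) auto
  have WV: "W x \<le> V x" for x
    unfolding V_def W_def by (rule sum_mono) (rule real_of_nat_le_square)
  have le: "measure_pmf.expectation p (\<lambda>x. of_bool (m \<le> W x \<and> V x < real k)) \<le> c / (\<delta> * m)" for k
  proof -
    have "m * measure_pmf.expectation p (\<lambda>x. of_bool (m \<le> W x \<and> V x < real k))
        = measure_pmf.expectation p (\<lambda>x. m * of_bool (m \<le> W x \<and> V x < real k))" by simp
    also have "\<dots> \<le> measure_pmf.expectation p (\<lambda>x. of_bool (V x < real k) * W x)"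
    proof (rule integral_mono)
      show "integrable (measure_pmf p) (\<lambda>x. m * of_bool (m \<le> W x \<and> V x < real k))"
        using m by (intro integrable_pmf_bounded[where b=m]) auto
      show "integrable (measure_pmf p) (\<lambda>x. of_bool (V x < real k) * W x)"
        using W0 order.trans[OF WV] by (intro integrable_pmf_bounded[where b="real k"]) (auto simp: less_imp_le)
    qed (use W0 in auto)
    finally have "\<delta> * (m * measure_pmf.expectation p (\<lambda>x. of_bool (m \<le> W x \<and> V x < real k)))
        \<le> \<delta> * measure_pmf.expectation p (\<lambda>x. of_bool (V x < real k) * W x)" using \<delta>0 by simp
    also have "\<dots> \<le> c"
      using expectation_boundary_truncated_le[OF p d, of "real k"] by (simp add: V_def W_def c_def \<delta>_def)
    finally show ?thesis using \<delta>0 m by (simp add: field_simps)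
  qed
  have "(\<lambda>k. measure_pmf.expectation p (\<lambda>x. of_bool (m \<le> W x \<and> V x < real k)))
      \<longlonglongrightarrow> (measure_pmf.expectation p (\<lambda>x. of_bool (m \<le> W x)) :: real)"
  proof (rule tendsto_pmf_expectation_bounded[where b=1])
    show "(\<lambda>k. of_bool (m \<le> W x \<and> V x < real k)) \<longlonglongrightarrow> (of_bool (m \<le> W x) :: real)" for x
    proof (rule tendsto_eventually)
      have "\<forall>\<^sub>F k in sequentially. V x < real k"
        using filterlim_real_sequentially by (auto simp: filterlim_at_top_dense)
      then show "\<forall>\<^sub>F k in sequentially. of_bool (m \<le> W x \<and> V x < real k) = (of_bool (m \<le> W x) :: real)"
        by eventually_elim auto
    qed
  qed auto
  then show ?thesis using le LIMSEQ_le_const2 unfolding c_def \<delta>_def W_def by blast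
qed

section \<open>Comparison with the network without central servers\<close>

lemma least_loaded_no_central:
  assumes d: "d \<in> D" "D \<subseteq> {1..n}" and no: "least_loaded E x d \<inter> C = {}"
  shows "least_loaded E x d = least_loaded (SIGMA d:D. B d) (restrict x (\<Union>d\<in>D. B d)) d"
proof -
  have d1: "1 \<le> d" "d \<le> n" using d by auto
  have "B d \<union> C \<noteq> {}" using card_B[OF d1(1)] K_pos by auto
  then obtain w where w: "w \<in> B d \<union> C" "\<And>v. v \<in> B d \<union> C \<Longrightarrow> x w \<le> x v"
    using ex_is_arg_min_if_finite[of "B d \<union> C" x] finite_C finite_B[OF d1(1)]
    by (auto simp: is_arg_min_linorder)
  then have "w \<in> least_loaded E x d" using d1 by (auto simp: least_loaded_def edge_iff)
  \<comment> \<open>The minimum over \<open>B d \<union> C\<close> is attained, and not in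
    \<open>C\<close>. It is thus attained in \<open>B d\<close>, and minimising over
    \<open>B d\<close> alone selects the same servers.\<close>
  then have wB: "w \<in> B d" using no w(1) by auto
  have rx: "restrict x (\<Union>d\<in>D. B d) u = x u" if "u \<in> B d" for u using that d by auto
  show ?thesis
  proof (rule set_eqI, rule iffI)
    fix u assume u: "u \<in> least_loaded E x d"
    then have "u \<in> B d" "\<And>v. v \<in> B d \<Longrightarrow> x u \<le> x v"
      using no d1 by (auto simp: least_loaded_def edge_iff)
    then show "u \<in> least_loaded (SIGMA d:D. B d) (restrict x (\<Union>d\<in>D. B d)) d"
      using d unfolding least_loaded_def by (auto simp: rx simp del: restrict_apply restrict_apply')
  next
    fix u assume "u \<in> least_loaded (SIGMA d:D. B d) (restrict x (\<Union>d\<in>D. B d)) d"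
    then have u: "u \<in> B d" and "x u \<le> x w"
      using d wB by (auto simp: least_loaded_def rx simp del: restrict_apply)
    have "x u \<le> x v" if "v \<in> B d \<union> C" for v
      using order.trans[OF \<open>x u \<le> x w\<close> w(2)[OF that]] .
    then show "u \<in> least_loaded E x d" using u d1 by (auto simp: least_loaded_def edge_iff)
  qed
qed

text \<open>Services agree exactly, as those outside \<open>T\<close> leave the restriction
  unchanged, and dispatchers outside \<open>D\<close> send nothing to \<open>T\<close>. A dispatcher
  of \<open>D\<close> acts differently in the two networks only when it sees a least loaded central
  server; each of its two arrival terms is then at most \<open>lam * (2 * b)\<close>, whence the
  constant \<open>4 * b * lam\<close>.\<close>

lemma operator_boundary_approx:
  assumes D: "D \<subseteq> {1..n}" and b: "\<And>x. \<bar>g x\<bar> \<le> b"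
  defines "T \<equiv> \<Union>d\<in>D. B d"
  shows "\<bar>L (\<lambda>y. g (restrict y T)) x -
      load_balancing_operator D T (SIGMA d:D. B d) (\<lambda>_. lam) (\<lambda>_. mu) g (restrict x T)\<bar>
    \<le> (\<Sum>d\<in>D. 4 * b * lam * of_bool (least_loaded E x d \<inter> C \<noteq> {}))"
proof -
  have b0: "0 \<le> b" using b[of undefined] by linarith
  have 2: "\<bar>g y - g z\<bar> \<le> 2 * b" for y z using b[of y] b[of z] by linarith
  have TS: "T \<subseteq> S" using D by (auto simp: T_def dandelion_servers_def)
  have upd_in: "restrict (x(u := a)) T = (restrict x T)(u := a)" if "u \<in> T" for u a
    using that by (auto simp: fun_eq_iff restrict_def)
  have upd_out: "restrict (x(u := a)) T = restrict x T" if "u \<notin> T" for u a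
    using that by (auto simp: fun_eq_iff restrict_def)
  define G where "G d = (\<Sum>u\<in>least_loaded E x d. lam / real (card (least_loaded E x d))
      * (g (restrict (x(u := x u + 1)) T) - g (restrict x T)))" for d
  define G' where "G' d = (\<Sum>u\<in>least_loaded (SIGMA d:D. B d) (restrict x T) d.
      lam / real (card (least_loaded (SIGMA d:D. B d) (restrict x T) d))
      * (g ((restrict x T)(u := restrict x T u + 1)) - g (restrict x T)))" for d
  have out: "G d = 0" if "d \<in> {1..n} - D" for d
    unfolding G_def
  proof (intro sum.neutral ballI)
    fix u assume "u \<in> least_loaded E x d"
    then have u: "u \<in> B d \<or> u \<in> C" by (auto simp: least_loaded_def edge_iff)
    have "u \<notin> B e" if "e \<in> D" for e
    proof -
      have "1 \<le> e" "d \<noteq> e" "1 \<le> d" using that D \<open>d \<in> {1..n} - D\<close> by auto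
      then show ?thesis using u B_eqD[of d e u] C_disjoint[of e] by auto
    qed
    then have "u \<notin> T" by (auto simp: T_def)
    then show "lam / real (card (least_loaded E x d)) * (g (restrict (x(u := x u + 1)) T) - g (restrict x T)) = 0"
      by (simp add: upd_out)
  qed
  have arr: "\<bar>G d - G' d\<bar> \<le> 4 * b * lam * of_bool (least_loaded E x d \<inter> C \<noteq> {})" if d: "d \<in> D" for d
  proof (cases "least_loaded E x d \<inter> C = {}")
    case True
    note ll = least_loaded_no_central[OF d D True, folded T_def]
    have "u \<in> T" if "u \<in> least_loaded (SIGMA d:D. B d) (restrict x T) d" for u
      using that d by (auto simp: least_loaded_def T_def)
    then have "G d = G' d" unfolding G_def G'_def ll by (intro sum.cong) (auto simp: upd_in)
    then show ?thesis using True by simp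
  next
    case False
    have "\<bar>G d\<bar> \<le> lam * (2 * b)" "\<bar>G' d\<bar> \<le> lam * (2 * b)"
      unfolding G_def G'_def using 2 b0 lam_pos by (intro abs_sum_uniform_weight_le; simp)+
    then show ?thesis using False by (simp add: algebra_simps)
  qed
  have "(\<Sum>u\<in>{u\<in>S. 0 < x u}. mu * (g (restrict (x(u := x u - 1)) T) - g (restrict x T)))
      = (\<Sum>u\<in>{u\<in>T. 0 < restrict x T u}. mu * (g ((restrict x T)(u := restrict x T u - 1)) - g (restrict x T)))"
  proof (rule sum.mono_neutral_cong_right)
    show "\<forall>i\<in>{u\<in>S. 0 < x u} - {u\<in>T. 0 < restrict x T u}.
        mu * (g (restrict (x(i := x i - 1)) T) - g (restrict x T)) = 0"
    proof
      fix i assume "i \<in> {u\<in>S. 0 < x u} - {u\<in>T. 0 < restrict x T u}"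
      then have "i \<notin> T" by auto
      then show "mu * (g (restrict (x(i := x i - 1)) T) - g (restrict x T)) = 0" by (simp add: upd_out)
    qed
  qed (use finite_S TS in \<open>auto simp: upd_in\<close>)
  moreover have "(\<Sum>d\<in>{1..n}. G d) = (\<Sum>d\<in>D. G d)"
    using D out by (intro sum.mono_neutral_right) auto
  ultimately have "L (\<lambda>y. g (restrict y T)) x -
      load_balancing_operator D T (SIGMA d:D. B d) (\<lambda>_. lam) (\<lambda>_. mu) g (restrict x T)
      = (\<Sum>d\<in>D. G d) - (\<Sum>d\<in>D. G' d)"
    unfolding load_balancing_operator_def G_def G'_def by simp
  also have "\<bar>\<dots>\<bar> \<le> (\<Sum>d\<in>D. \<bar>G d - G' d\<bar>)" unfolding sum_subtractf[symmetric] by (rule sum_abs)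
  also have "\<dots> \<le> (\<Sum>d\<in>D. 4 * b * lam * of_bool (least_loaded E x d \<inter> C \<noteq> {}))"
    by (intro sum_mono arr)
  finally show ?thesis .
qed

text \<open>Invariance annihilates the expectation of \<open>L\<close> at
  \<open>\<lambda>y. g (restrict y T)\<close>, so only the approximation error of the operators is
  left, and its expectation is of order \<open>1 / n\<close>.\<close>

lemma expectation_boundary_operator_le:
  assumes p: "invariant p" and D: "D \<subseteq> {1..n}" and b: "\<And>x. \<bar>g x\<bar> \<le> b"
  defines "T \<equiv> \<Union>d\<in>D. B d"
  shows "\<bar>measure_pmf.expectation (map_pmf (\<lambda>x. restrict x T) p)
      (load_balancing_operator D T (SIGMA d:D. B d) (\<lambda>_. lam) (\<lambda>_. mu) g)\<bar>
    \<le> real (card D) * (4 * b * lam * (real (K + card C) * (mu * real (card C) / (lam * real n))))"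
proof -
  let ?L' = "load_balancing_operator D T (SIGMA d:D. B d) (\<lambda>_. lam) (\<lambda>_. mu) g"
  have finD: "finite D" using D finite_subset by blast
  have b0: "0 \<le> b" using b[of undefined] by linarith
  interpret T: load_balancing D T "SIGMA d:D. B d" "\<lambda>_. lam" "\<lambda>_. mu"
    by unfold_locales
      (use finD D finite_B lam_pos mu_pos' in \<open>auto simp: T_def subset_iff\<close>)
  have int: "integrable (measure_pmf p) (\<lambda>x. ?L' (restrict x T))"
    by (rule integrable_pmf_bounded[OF T.operator_abs_le[OF b]])
  have int': "integrable (measure_pmf p) (L (\<lambda>y. g (restrict y T)))"
    by (rule integrable_operator[of "\<lambda>y. g (restrict y T)", OF b])
  have "\<bar>measure_pmf.expectation (map_pmf (\<lambda>x. restrict x T) p) ?L'\<bar>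
      = \<bar>measure_pmf.expectation p (L (\<lambda>y. g (restrict y T))) - measure_pmf.expectation p (\<lambda>x. ?L' (restrict x T))\<bar>"
    using load_balancing_invariantD[OF p, of "\<lambda>y. g (restrict y T)" b] b by simp
  also have "\<dots> = \<bar>measure_pmf.expectation p (\<lambda>x. L (\<lambda>y. g (restrict y T)) x - ?L' (restrict x T))\<bar>"
    by (subst Bochner_Integration.integral_diff[OF int' int]) simp
  also have "\<dots> \<le> measure_pmf.expectation p (\<lambda>x. \<bar>L (\<lambda>y. g (restrict y T)) x - ?L' (restrict x T)\<bar>)"
    by (rule integral_abs_bound)
  also have "\<dots> \<le> measure_pmf.expectation p (\<lambda>x. \<Sum>d\<in>D. 4 * b * lam * of_bool (least_loaded E x d \<inter> C \<noteq> {}))"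
    using operator_boundary_approx[OF D b] unfolding T_def[symmetric]
    by (intro integral_mono integrable_abs Bochner_Integration.integrable_diff int int' Bochner_Integration.integrable_sum
         integrable_mult_right integrable_pmf_bounded[where b=1]) auto
  also have "\<dots> = (\<Sum>d\<in>D. 4 * b * lam * measure_pmf.expectation p (\<lambda>x. of_bool (least_loaded E x d \<inter> C \<noteq> {})))"
    by (subst Bochner_Integration.integral_sum) (auto intro!: integrable_pmf_bounded[where b=1] simp del: of_bool_eq_iff)
  also have "\<dots> \<le> (\<Sum>d\<in>D. 4 * b * lam * (real (K + card C) * (mu * real (card C) / (lam * real n))))"
    using D b0 lam_pos by (intro sum_mono mult_left_mono prob_central_least_loaded_le[OF p]) auto
  finally show ?thesis by simp
qed

end

section \<open>Tightness and convergence of discrete laws\<close>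

text \<open>Scheffe's lemma: as the limit has full mass 1, pointwise convergence of the masses is
  convergence in l1, which bounded functions respect.\<close>

lemma pointwise_imp_expectation_tendsto:
  fixes q :: "'a pmf" and f :: "'a \<Rightarrow> real"
  assumes lim: "\<And>x. (\<lambda>k. pmf (p k) x) \<longlonglongrightarrow> pmf q x" and b: "\<And>x. \<bar>f x\<bar> \<le> b"
  shows "(\<lambda>k. measure_pmf.expectation (p k) f) \<longlonglongrightarrow> measure_pmf.expectation q f"
proof -
  let ?N = "\<lambda>k. \<integral>x. \<bar>pmf (p k) x - pmf q x\<bar> \<partial>count_space UNIV"
  have i: "integrable (count_space UNIV) (\<lambda>x. \<bar>pmf (p k) x - pmf q x\<bar>)" for k
    by (intro integrable_abs Bochner_Integration.integrable_diff integrable_pmf)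
  have "(\<lambda>k. \<integral>\<^sup>+x. norm (pmf (p k) x - pmf q x) \<partial>count_space UNIV) \<longlonglongrightarrow> 0"
    by (rule Scheffe_lemma2) (use lim in \<open>auto simp: integrable_pmf nn_integral_pmf' bij_betw_def\<close>)
  also have "(\<lambda>k. \<integral>\<^sup>+x. norm (pmf (p k) x - pmf q x) \<partial>count_space UNIV) = (\<lambda>k. ennreal (?N k))"
    by (rule ext) (use i in \<open>simp add: nn_integral_eq_integral\<close>)
  finally have "?N \<longlonglongrightarrow> 0"
    using tendsto_ennrealD[of ?N 0 sequentially] by (simp add: always_eventually)
  then have N: "(\<lambda>k. b * ?N k) \<longlonglongrightarrow> 0" by (rule tendsto_mult_right_zero)
  have ex: "measure_pmf.expectation r f = (\<integral>x. pmf r x * f x \<partial>count_space UNIV)"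
    and ix: "integrable (count_space UNIV) (\<lambda>x. pmf r x * f x)" for r
    using integrable_pmf_bounded[of r f b] b
    by (simp_all add: measure_pmf_eq_density integrable_density integral_density)
  have "\<bar>measure_pmf.expectation (p k) f - measure_pmf.expectation q f\<bar> \<le> b * ?N k" for k
  proof -
    have "measure_pmf.expectation (p k) f - measure_pmf.expectation q f
        = (\<integral>x. (pmf (p k) x - pmf q x) * f x \<partial>count_space UNIV)"
      unfolding ex left_diff_distrib by (rule Bochner_Integration.integral_diff[OF ix ix, symmetric])
    also have "\<bar>\<dots>\<bar> \<le> (\<integral>x. \<bar>(pmf (p k) x - pmf q x) * f x\<bar> \<partial>count_space UNIV)" by (rule integral_abs_bound)
    also have "\<dots> \<le> (\<integral>x. \<bar>pmf (p k) x - pmf q x\<bar> * b \<partial>count_space UNIV)"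
    proof (rule integral_mono)
      show "integrable (count_space UNIV) (\<lambda>x. \<bar>(pmf (p k) x - pmf q x) * f x\<bar>)"
        unfolding left_diff_distrib by (intro integrable_abs Bochner_Integration.integrable_diff ix)
      show "integrable (count_space UNIV) (\<lambda>x. \<bar>pmf (p k) x - pmf q x\<bar> * b)"
        by (intro integrable_mult_left i)
    qed (use b in \<open>auto simp: abs_mult intro: mult_left_mono\<close>)
    finally show ?thesis by (simp add: mult.commute)
  qed
  then have "(\<lambda>k. measure_pmf.expectation (p k) f - measure_pmf.expectation q f) \<longlonglongrightarrow> 0"
    by (intro Lim_null_comparison[OF _ N] always_eventually allI) (simp only: real_norm_def)
  then show ?thesis by (rule LIM_zero_cancel)
qed

text \<open>Prokhorov's theorem in the discrete case. A diagonal argument over an enumeration of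
  \<open>\<Omega>\<close> makes all point masses converge; Fatou's lemma bounds the limiting mass
  above by 1, and tightness bounds it below.\<close>

lemma tight_pmf_subsequence:
  fixes p :: "nat \<Rightarrow> 'a pmf"
  assumes \<Omega>: "countable \<Omega>" "\<And>k. set_pmf (p k) \<subseteq> \<Omega>"
    and tight: "\<And>e. 0 < e \<Longrightarrow> \<exists>F. finite F \<and> (\<forall>k. measure_pmf.prob (p k) F \<ge> 1 - e)"
  obtains r q where "strict_mono (r :: nat \<Rightarrow> nat)" "set_pmf q \<subseteq> \<Omega>"
    "\<And>x. (\<lambda>k. pmf (p (r k)) x) \<longlonglongrightarrow> pmf q x"
proof -
  define a where "a i = from_nat_into \<Omega> i" for i
  interpret subseqs "\<lambda>i s. convergent (\<lambda>k. pmf (p (s k)) (a i))"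
  proof
    fix i :: nat and s :: "nat \<Rightarrow> nat"
    have "seq_compact {0..1::real}" by (intro compact_imp_seq_compact compact_Icc)
    moreover have "\<forall>k. pmf (p (s k)) (a i) \<in> {0..1}" by (simp add: pmf_le_1)
    ultimately obtain l r' where "strict_mono r'" "((\<lambda>k. pmf (p (s k)) (a i)) \<circ> r') \<longlonglongrightarrow> l"
      by (rule seq_compactE)
    then show "\<exists>r'. strict_mono r' \<and> convergent (\<lambda>k. pmf (p ((s \<circ> r') k)) (a i))"
      by (auto simp: convergent_def comp_def)
  qed
  define r where "r = diagseq"
  have r: "strict_mono r" unfolding r_def by (rule subseq_diagseq)
  \<comment> \<open>After its first \<open>Suc i\<close> terms the diagonal sequence is a
    subsequence of the one chosen for \<open>a i\<close>; dropping finitely many terms does not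
    affect convergence.\<close>
  have "convergent (\<lambda>k. pmf (p ((diagseq \<circ> (+) (Suc i)) k)) (a i))" for i
  proof (rule diagseq_holds)
    show "convergent (\<lambda>k. pmf (p ((s \<circ> r') k)) (a n))"
      if "strict_mono r'" "convergent (\<lambda>k. pmf (p (s k)) (a n))" for r' s n
      using convergent_subseq_convergent[OF that(2,1)] by (simp add: comp_def)
  qed
  moreover have "(\<lambda>k. pmf (p ((diagseq \<circ> (+) (Suc i)) k)) (a i)) = (\<lambda>k. pmf (p (r (k + Suc i))) (a i))" for i
    by (rule ext) (simp only: r_def comp_apply add.commute)
  ultimately have "convergent (\<lambda>k. pmf (p (r (k + Suc i))) (a i))" for i by metis
  then have "convergent (\<lambda>k. pmf (p (r k)) (a i))" for i
    using convergent_ignore_initial_segment[of "\<lambda>k. pmf (p (r k)) (a i)" "Suc i"] by blast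
  then have c\<Omega>: "convergent (\<lambda>k. pmf (p (r k)) x)" if "x \<in> \<Omega>" for x
    using from_nat_into_surj[OF \<Omega>(1) that] unfolding a_def by metis
  have out: "pmf (p k) x = 0" if "x \<notin> \<Omega>" for k x using \<Omega>(2)[of k] that by (auto simp: set_pmf_iff)
  have conv: "convergent (\<lambda>k. pmf (p (r k)) x)" for x
    using c\<Omega>[of x] out[of x] by (cases "x \<in> \<Omega>") (auto simp: convergent_const)
  define l where "l x = lim (\<lambda>k. pmf (p (r k)) x)" for x
  have l: "(\<lambda>k. pmf (p (r k)) x) \<longlonglongrightarrow> l x" for x
    using conv unfolding l_def convergent_LIMSEQ_iff by blast
  have l0: "0 \<le> l x" for x by (rule LIMSEQ_le_const[OF l]) auto
  have "(\<integral>\<^sup>+x. ennreal (l x) \<partial>count_space UNIV) \<le> 1"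
  proof -
    have "ennreal (l x) = liminf (\<lambda>k. ennreal (pmf (p (r k)) x))" for x
      using l by (intro lim_imp_Liminf[symmetric]) auto
    then have "(\<integral>\<^sup>+x. ennreal (l x) \<partial>count_space UNIV)
        = (\<integral>\<^sup>+x. liminf (\<lambda>k. ennreal (pmf (p (r k)) x)) \<partial>count_space UNIV)" by simp
    also have "\<dots> \<le> liminf (\<lambda>k. \<integral>\<^sup>+x. ennreal (pmf (p (r k)) x) \<partial>count_space UNIV)"
      by (rule nn_integral_liminf) simp
    also have "\<dots> = 1" by (simp add: nn_integral_pmf' bij_betw_def Liminf_const)
    finally show ?thesis .
  qed
  moreover have "1 \<le> (\<integral>\<^sup>+x. ennreal (l x) \<partial>count_space UNIV)"
  proof (rule ennreal_le_epsilon)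
    fix e :: real assume e: "0 < e"
    obtain F where F: "finite F" "\<And>k. measure_pmf.prob (p k) F \<ge> 1 - e" using tight[OF e] by blast
    have "(\<lambda>k. \<Sum>x\<in>F. pmf (p (r k)) x) \<longlonglongrightarrow> (\<Sum>x\<in>F. l x)" by (intro tendsto_sum l)
    then have "1 - e \<le> (\<Sum>x\<in>F. l x)"
      using F by (intro LIMSEQ_le_const[where X="\<lambda>k. \<Sum>x\<in>F. pmf (p (r k)) x"])
        (auto simp: measure_measure_pmf_finite)
    then have "1 \<le> ennreal ((\<Sum>x\<in>F. l x) + e)" using e by simp
    also have "\<dots> = (\<Sum>x\<in>F. ennreal (l x)) + ennreal e"
      using l0 e by (simp add: sum_nonneg sum_ennreal)
    also have "(\<Sum>x\<in>F. ennreal (l x)) = (\<integral>\<^sup>+x. ennreal (l x) \<partial>count_space F)"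
      using F by (simp add: nn_integral_count_space_finite)
    also have "\<dots> \<le> (\<integral>\<^sup>+x. ennreal (l x) \<partial>count_space UNIV)"
      by (simp add: nn_integral_count_space_indicator, intro nn_integral_mono) (auto split: split_indicator)
    finally show "1 \<le> (\<integral>\<^sup>+x. ennreal (l x) \<partial>count_space UNIV) + ennreal e" by (simp add: add_right_mono)
  qed
  ultimately have "(\<integral>\<^sup>+x. ennreal (l x) \<partial>count_space UNIV) = 1" by (rule antisym)
  then have pmf: "pmf (embed_pmf l) x = l x" for x using l0 by (intro pmf_embed_pmf) auto
  show thesis
  proof (rule that[of r "embed_pmf l"])
    have "l x = 0" if "x \<notin> \<Omega>" for x using out[OF that] by (simp add: l_def)
    then show "set_pmf (embed_pmf l) \<subseteq> \<Omega>" by (metis pmf set_pmf_iff subsetI)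
  qed (use r l pmf in auto)
qed

text \<open>Were the claim false, some subsequence would stay at distance \<open>e\<close> from the
  target; by tightness it has a further subsequence that converges, and \<open>unique\<close>
  identifies its limit as \<open>q\<close>.\<close>

lemma tight_pmf_tendsto:
  fixes p :: "nat \<Rightarrow> 'a pmf" and f :: "'a \<Rightarrow> real"
  assumes \<Omega>: "countable \<Omega>" "\<And>k. set_pmf (p k) \<subseteq> \<Omega>"
    and tight: "\<And>e. 0 < e \<Longrightarrow> \<exists>F. finite F \<and> (\<forall>k. measure_pmf.prob (p k) F \<ge> 1 - e)"
    and unique: "\<And>r q'. strict_mono r \<Longrightarrow> set_pmf q' \<subseteq> \<Omega> \<Longrightarrow>
      (\<And>x. (\<lambda>k. pmf (p (r k)) x) \<longlonglongrightarrow> pmf q' x) \<Longrightarrow> q' = q"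
    and b: "\<And>x. \<bar>f x\<bar> \<le> b"
  shows "(\<lambda>k. measure_pmf.expectation (p k) f) \<longlonglongrightarrow> measure_pmf.expectation q f"
proof (rule ccontr)
  let ?E = "\<lambda>k. measure_pmf.expectation (p k) f" and ?e = "measure_pmf.expectation q f"
  assume "\<not> ?E \<longlonglongrightarrow> ?e"
  then obtain e where e: "0 < e" and "\<not> (\<forall>\<^sub>F k in sequentially. dist (?E k) ?e < e)"
    unfolding tendsto_iff by blast
  then have "\<exists>\<^sub>F k in sequentially. e \<le> dist (?E k) ?e"
    by (simp add: not_eventually not_less)
  then have "infinite {k. e \<le> dist (?E k) ?e}"
    by (simp add: frequently_cofinite[symmetric] cofinite_eq_sequentially)
  then obtain s :: "nat \<Rightarrow> nat" where s: "strict_mono s" "\<And>k. e \<le> dist (?E (s k)) ?e"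
    using infinite_enumerate[of "{k. e \<le> dist (?E k) ?e}"] by auto
  obtain r q' where r: "strict_mono r" "set_pmf q' \<subseteq> \<Omega>"
      "\<And>x. (\<lambda>k. pmf (p (s (r k))) x) \<longlonglongrightarrow> pmf q' x"
  proof (rule tight_pmf_subsequence[of \<Omega> "\<lambda>k. p (s k)"])
    show "\<exists>F. finite F \<and> (\<forall>k. 1 - e \<le> measure_pmf.prob (p (s k)) F)" if "0 < e" for e
      using tight[OF that] by blast
  qed (use \<Omega> in auto)
  have "q' = q"
    using unique[of "s \<circ> r" q'] strict_mono_o[OF s(1) r(1)] r(2,3) by (simp add: comp_def)
  then have "(\<lambda>k. ?E (s (r k))) \<longlonglongrightarrow> ?e"
    using pointwise_imp_expectation_tendsto[OF r(3) b] by simp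
  then have "\<forall>\<^sub>F k in sequentially. dist (?E (s (r k))) ?e < e" using e by (rule tendstoD)
  then obtain k where "dist (?E (s (r k))) ?e < e" by (auto simp: eventually_sequentially)
  then show False using s(2)[of "r k"] by simp
qed

section \<open>Products of basic processes\<close>

text \<open>Glues vectors on the pairwise disjoint \<open>B d\<close>; the description in the definition is unique only under this
  disjointness.\<close>
definition assemble :: "'d set \<Rightarrow> ('d \<Rightarrow> 's set) \<Rightarrow> ('d \<Rightarrow> 's \<Rightarrow> nat) \<Rightarrow> 's \<Rightarrow> nat" where
  "assemble D B h u = (if \<exists>d\<in>D. u \<in> B d then h (THE d. d \<in> D \<and> u \<in> B d) u else undefined)"

lemma assemble_in:
  assumes "disjoint_family_on B D" "d \<in> D" "u \<in> B d"
  shows "assemble D B h u = h d u"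
proof -
  have "(THE e. e \<in> D \<and> u \<in> B e) = d"
    using assms by (intro the_equality) (auto simp: disjoint_family_on_def)
  then show ?thesis using assms by (auto simp: assemble_def)
qed

lemma assemble_out: "u \<notin> (\<Union>d\<in>D. B d) \<Longrightarrow> assemble D B h u = undefined"
  by (auto simp: assemble_def)

lemma assemble_nat_vectors: "assemble D B h \<in> nat_vectors (\<Union>d\<in>D. B d)"
  by (auto simp: PiE_iff extensional_def assemble_out)

text \<open>Without central servers every transition touches a single \<open>B d\<close>, so the
  generator is a sum of basic generators, each acting on one block with the others frozen.\<close>

lemma operator_assemble:
  fixes B :: "'d \<Rightarrow> 's set"
  assumes dis: "disjoint_family_on B D" and fin: "finite D" "\<And>d. d \<in> D \<Longrightarrow> finite (B d)"
  shows "load_balancing_operator D (\<Union>d\<in>D. B d) (SIGMA d:D. B d) (\<lambda>_. lam) (\<lambda>_. mu) g (assemble D B h)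
    = (\<Sum>d\<in>D. load_balancing_operator {()} (B d) ({()} \<times> B d) (\<lambda>_. lam) (\<lambda>_. mu)
        (\<lambda>z. g (assemble D B (h(d := z)))) (h d))"
proof -
  let ?a = "assemble D B"
  have ain: "?a h' u = h' d u" if "d \<in> D" "u \<in> B d" for d u h'
    using assemble_in[OF dis that] .
  \<comment> \<open>Disjointness enters here: a change at a server of \<open>B d\<close> is a change
    of the block \<open>h d\<close> alone.\<close>
  have upd: "(?a h)(u := a) = ?a (h(d := (h d)(u := a)))" if "d \<in> D" "u \<in> B d" for u a d
  proof
    fix v
    show "((?a h)(u := a)) v = ?a (h(d := (h d)(u := a))) v"
    proof (cases "\<exists>e\<in>D. v \<in> B e")
      case True
      then obtain e where e: "e \<in> D" "v \<in> B e" by auto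
      then have "e = d" if "v = u" using dis \<open>d \<in> D\<close> \<open>u \<in> B d\<close> that by (auto simp: disjoint_family_on_def)
      then show ?thesis using e by (auto simp: ain[OF e])
    next
      case False
      then show ?thesis using that by (auto simp: assemble_out)
    qed
  qed
  have ll: "least_loaded (SIGMA d:D. B d) (?a h) d = least_loaded ({()} \<times> B d) (h d) ()" if "d \<in> D" for d
    using that by (auto simp: least_loaded_def ain)
  have lsub: "u \<in> B d" if "u \<in> least_loaded ({()} \<times> B d) x ()" for u d and x :: "'s \<Rightarrow> nat"
    using that by (auto simp: least_loaded_def)
  have arr: "(\<Sum>d\<in>D. \<Sum>u\<in>least_loaded (SIGMA d:D. B d) (?a h) d.
      lam / real (card (least_loaded (SIGMA d:D. B d) (?a h) d)) * (g ((?a h)(u := ?a h u + 1)) - g (?a h)))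
    = (\<Sum>d\<in>D. \<Sum>u\<in>least_loaded ({()} \<times> B d) (h d) ().
      lam / real (card (least_loaded ({()} \<times> B d) (h d) ()))
      * (g (?a (h(d := (h d)(u := h d u + 1)))) - g (?a h)))"
  proof (rule sum.cong[OF refl])
    fix d assume d: "d \<in> D"
    show "(\<Sum>u\<in>least_loaded (SIGMA d:D. B d) (?a h) d.
        lam / real (card (least_loaded (SIGMA d:D. B d) (?a h) d)) * (g ((?a h)(u := ?a h u + 1)) - g (?a h)))
      = (\<Sum>u\<in>least_loaded ({()} \<times> B d) (h d) ().
        lam / real (card (least_loaded ({()} \<times> B d) (h d) ()))
        * (g (?a (h(d := (h d)(u := h d u + 1)))) - g (?a h)))"
      unfolding ll[OF d]
    proof (rule sum.cong[OF refl])
      fix u assume "u \<in> least_loaded ({()} \<times> B d) (h d) ()"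
      then have "u \<in> B d" by (rule lsub)
      then show "lam / real (card (least_loaded ({()} \<times> B d) (h d) ())) * (g ((?a h)(u := ?a h u + 1)) - g (?a h))
        = lam / real (card (least_loaded ({()} \<times> B d) (h d) ()))
        * (g (?a (h(d := (h d)(u := h d u + 1)))) - g (?a h))"
        by (simp only: upd[OF d] ain[OF d])
    qed
  qed
  have "{u \<in> \<Union>d\<in>D. B d. 0 < ?a h u} = (\<Union>d\<in>D. {u\<in>B d. 0 < h d u})" by (auto simp: ain)
  then have "(\<Sum>u\<in>{u \<in> \<Union>d\<in>D. B d. 0 < ?a h u}. mu * (g ((?a h)(u := ?a h u - 1)) - g (?a h)))
    = (\<Sum>d\<in>D. \<Sum>u\<in>{u\<in>B d. 0 < h d u}. mu * (g ((?a h)(u := ?a h u - 1)) - g (?a h)))"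
    using fin dis unfolding disjoint_family_on_def by (simp only:) (rule sum.UNION_disjoint, auto, blast)
  also have "\<dots> = (\<Sum>d\<in>D. \<Sum>u\<in>{u\<in>B d. 0 < h d u}. mu * (g (?a (h(d := (h d)(u := h d u - 1)))) - g (?a h)))"
  proof (rule sum.cong[OF refl], rule sum.cong[OF refl])
    fix d u assume d: "d \<in> D" and u: "u \<in> {u\<in>B d. 0 < h d u}"
    then have u: "u \<in> B d" by simp
    show "mu * (g ((?a h)(u := ?a h u - 1)) - g (?a h))
      = mu * (g (?a (h(d := (h d)(u := h d u - 1)))) - g (?a h))"
      by (simp only: upd[OF d u] ain[OF d u])
  qed
  finally show ?thesis
    unfolding load_balancing_operator_def arr by (simp add: sum.distrib)
qed

text \<open>Given the other blocks, block \<open>d\<close> still has law \<open>p d\<close>, so the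
  summand of \<open>operator_assemble\<close> belonging to \<open>d\<close> integrates to 0 over
  that block.\<close>

lemma Pi_pmf_assemble_invariant:
  fixes B :: "'d \<Rightarrow> 's set"
  assumes dis: "disjoint_family_on B D" and fin: "finite D" "\<And>d. d \<in> D \<Longrightarrow> finite (B d)"
    and lam: "0 \<le> lam" and mu: "0 < mu"
    and p: "\<And>d. d \<in> D \<Longrightarrow> load_balancing_invariant {()} (B d) ({()} \<times> B d) (\<lambda>_. lam) (\<lambda>_. mu) (p d)"
  shows "load_balancing_invariant D (\<Union>d\<in>D. B d) (SIGMA d:D. B d) (\<lambda>_. lam) (\<lambda>_. mu)
    (map_pmf (assemble D B) (Pi_pmf D dflt p))"
  unfolding load_balancing_invariant_def
proof (intro conjI allI impI)
  show "set_pmf (map_pmf (assemble D B) (Pi_pmf D dflt p)) \<subseteq> nat_vectors (\<Union>d\<in>D. B d)"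
    unfolding set_map_pmf by (intro image_subsetI assemble_nat_vectors)
  fix g :: "('s \<Rightarrow> nat) \<Rightarrow> real" and b assume b: "\<forall>x. \<bar>g x\<bar> \<le> b"
  define H where "H d h = load_balancing_operator {()} (B d) ({()} \<times> B d) (\<lambda>_. lam) (\<lambda>_. mu)
        (\<lambda>z. g (assemble D B (h(d := z)))) (h d)" for d h
  have lb: "load_balancing {()} (B d) ({()} \<times> B d) (\<lambda>_. lam) (\<lambda>_. mu)" if "d \<in> D" for d
    by unfold_locales (use fin that lam mu in auto)
  have Hb: "\<bar>H d h\<bar> \<le> 2 * b * load_balancing.total_rate {()} (B d) (\<lambda>_. lam) (\<lambda>_. mu)" if "d \<in> D" for d h
    unfolding H_def by (rule load_balancing.operator_abs_le[OF lb[OF that]]) (use b in auto)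
  have "measure_pmf.expectation (Pi_pmf D dflt p) (H d) = 0" if d: "d \<in> D" for d
  proof -
    define F where "F = Pi_pmf (D - {d}) dflt p"
    have "Pi_pmf D dflt p = Pi_pmf (insert d (D - {d})) dflt p" using d by (simp add: insert_absorb)
    also have "\<dots> = do {y \<leftarrow> p d; f \<leftarrow> F; return_pmf (f(d := y))}"
      unfolding F_def using fin by (intro Pi_pmf_insert') auto
    \<comment> \<open>Block \<open>d\<close> is drawn last, so that it is integrated first, with the
      other blocks fixed.\<close>
    also have "\<dots> = do {f \<leftarrow> F; y \<leftarrow> p d; return_pmf (f(d := y))}" by (rule bind_commute_pmf)
    also have "\<dots> = do {f \<leftarrow> F; map_pmf (\<lambda>y. f(d := y)) (p d)}" by (simp add: map_pmf_def)
    finally have "measure_pmf.expectation (Pi_pmf D dflt p) (H d)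
      = measure_pmf.expectation F (\<lambda>f. measure_pmf.expectation (map_pmf (\<lambda>y. f(d := y)) (p d)) (H d))"
      by (simp only:) (rule expectation_bind_pmf_bounded[OF Hb[OF d]])
    also have "\<dots> = measure_pmf.expectation F (\<lambda>f. 0)"
    proof (rule Bochner_Integration.integral_cong[OF refl])
      fix f
      show "measure_pmf.expectation (map_pmf (\<lambda>y. f(d := y)) (p d)) (H d) = 0"
        using load_balancing_invariantD[OF p[OF d], of "\<lambda>z. g (assemble D B (f(d := z)))" b] b
        by (simp add: H_def)
    qed
    finally show ?thesis by simp
  qed
  moreover have "measure_pmf.expectation (Pi_pmf D dflt p) (\<lambda>h. \<Sum>d\<in>D. H d h)
      = (\<Sum>d\<in>D. measure_pmf.expectation (Pi_pmf D dflt p) (H d))"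
    by (intro Bochner_Integration.integral_sum integrable_pmf_bounded[OF Hb])
  ultimately show "measure_pmf.expectation (map_pmf (assemble D B) (Pi_pmf D dflt p))
      (load_balancing_operator D (\<Union>d\<in>D. B d) (SIGMA d:D. B d) (\<lambda>_. lam) (\<lambda>_. mu) g) = 0"
    by (simp add: operator_assemble[OF dis fin] H_def)
qed

section \<open>Identification of the law of a vector with independent blocks\<close>

lemma measurable_count_space_superset:
  assumes "f \<in> measurable M (count_space A)" "A \<subseteq> B"
  shows "f \<in> measurable M (count_space B)"
  using measurable_compose[OF assms(1), of "\<lambda>x. x" "count_space B"] assms(2) by auto

text \<open>Both laws live on a countable set, so point masses suffice. The event
  \<open>Y = y\<close> says that every block of \<open>Y\<close> equals the corresponding block of
  \<open>y\<close>, and independence factorises its probability.\<close>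

lemma distr_indep_eq_Pi_pmf:
  fixes B :: "'d \<Rightarrow> 's set" and Y :: "'w \<Rightarrow> 's \<Rightarrow> nat"
  assumes N: "prob_space N"
    and dis: "disjoint_family_on B D" and fin: "finite D" "\<And>d. d \<in> D \<Longrightarrow> finite (B d)"
    and Y: "Y \<in> measurable N (count_space (nat_vectors (\<Union>d\<in>D. B d)))"
    and indep: "prob_space.indep_vars N (\<lambda>d. count_space (nat_vectors (B d)))
      (\<lambda>d \<omega>. restrict (Y \<omega>) (B d)) D"
    and p: "\<And>d. d \<in> D \<Longrightarrow> distr N (count_space UNIV) (\<lambda>\<omega>. restrict (Y \<omega>) (B d)) = measure_pmf (p d)"
  shows "distr N (count_space UNIV) Y = measure_pmf (map_pmf (assemble D B) (Pi_pmf D undefined p))"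
proof -
  interpret prob_space N by (rule N)
  let ?T = "\<Union>d\<in>D. B d" and ?P = "Pi_pmf D undefined p"
  have finT: "finite ?T" using fin by auto
  have YU: "Y \<in> measurable N (count_space UNIV)"
    by (rule measurable_count_space_superset[OF Y]) simp
  have YT: "Y \<omega> \<in> nat_vectors ?T" if "\<omega> \<in> space N" for \<omega>
    using measurable_space[OF Y that] by simp
  show ?thesis
  proof (rule measure_eqI_countable_AE[where \<Omega>="nat_vectors ?T"])
    show "countable (nat_vectors ?T)" using finT by (intro countable_PiE) auto
    show "AE x in distr N (count_space UNIV) Y. x \<in> nat_vectors ?T"
      using YU YT by (subst AE_distr_iff) auto
    show "AE x in measure_pmf (map_pmf (assemble D B) ?P). x \<in> nat_vectors ?T"
      unfolding AE_measure_pmf_iff set_map_pmf by (rule ballI) (elim imageE, simp only: assemble_nat_vectors)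
    fix y assume y: "y \<in> nat_vectors ?T"
    \<comment> \<open>The blocks of \<open>y\<close>; outside \<open>D\<close> the value must be
      \<open>undefined\<close>, the default value of the product law, for \<open>s\<close> to have
      the expected mass.\<close>
    define s where "s d = (if d \<in> D then restrict y (B d) else undefined)" for d
    have as: "assemble D B s = y"
    proof
      fix u
      show "assemble D B s u = y u"
      proof (cases "u \<in> ?T")
        case True
        then obtain d where d: "d \<in> D" "u \<in> B d" by auto
        then show ?thesis by (simp add: assemble_in[OF dis d] s_def)
      next
        case False
        then show ?thesis using assemble_out[OF False, of s] PiE_arb[OF y False] by (simp only:)
      qed
    qed
    have prob_p: "prob ((\<lambda>\<omega>. restrict (Y \<omega>) (B d)) -` {s d} \<inter> space N) = pmf (p d) (s d)" if d: "d \<in> D" for d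
    proof -
      have "(\<lambda>\<omega>. restrict (Y \<omega>) (B d)) \<in> measurable N (count_space UNIV)"
        using measurable_compose[OF YU, of "\<lambda>x. restrict x (B d)" "count_space UNIV"] by simp
      then have "measure (distr N (count_space UNIV) (\<lambda>\<omega>. restrict (Y \<omega>) (B d))) {s d}
        = prob ((\<lambda>\<omega>. restrict (Y \<omega>) (B d)) -` {s d} \<inter> space N)" by (rule measure_distr) simp
      then show ?thesis unfolding p[OF d] by (simp add: measure_pmf_single)
    qed
    have supp: "set_pmf (p d) \<subseteq> nat_vectors (B d)" if d: "d \<in> D" for d
    proof
      fix x assume "x \<in> set_pmf (p d)"
      then have "measure (distr N (count_space UNIV) (\<lambda>\<omega>. restrict (Y \<omega>) (B d))) {x} \<noteq> 0"
        unfolding p[OF d] by (simp add: measure_pmf_single set_pmf_iff)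
      moreover have "(\<lambda>\<omega>. restrict (Y \<omega>) (B d)) \<in> measurable N (count_space UNIV)"
        using measurable_compose[OF YU, of "\<lambda>x. restrict x (B d)" "count_space UNIV"] by simp
      ultimately have "prob ((\<lambda>\<omega>. restrict (Y \<omega>) (B d)) -` {x} \<inter> space N) \<noteq> 0"
        by (subst (asm) measure_distr) auto
      then have "(\<lambda>\<omega>. restrict (Y \<omega>) (B d)) -` {x} \<inter> space N \<noteq> {}" by auto
      then show "x \<in> nat_vectors (B d)" by auto
    qed
    have "measure (distr N (count_space UNIV) Y) {y} = prob (Y -` {y} \<inter> space N)"
      using YU by (rule measure_distr) simp
    also have "\<dots> = (\<Prod>d\<in>D. pmf (p d) (s d))"
    \<comment> \<open>\<open>indep_varsD_finite\<close> asks for a nonempty index set. With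
      \<open>D\<close> empty, \<open>Y\<close> takes only one value, the function undefined
      everywhere.\<close>
    proof (cases "D = {}")
      case True
      then have "Y -` {y} \<inter> space N = space N" using YT y by auto
      then show ?thesis using True prob_space by simp
    next
      case False
      have "Y -` {y} \<inter> space N = (\<Inter>d\<in>D. (\<lambda>\<omega>. restrict (Y \<omega>) (B d)) -` {s d} \<inter> space N)"
      proof (intro equalityI subsetI)
        fix \<omega> assume \<omega>: "\<omega> \<in> (\<Inter>d\<in>D. (\<lambda>\<omega>. restrict (Y \<omega>) (B d)) -` {s d} \<inter> space N)"
        then have sp: "\<omega> \<in> space N" using False by auto
        have "Y \<omega> u = y u" for u
        proof (cases "u \<in> ?T")
          case True
          then obtain d where d: "d \<in> D" "u \<in> B d" by auto
          have "restrict (Y \<omega>) (B d) = s d" using INT_D[OF \<omega> d(1)] by simp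
          then have "restrict (Y \<omega>) (B d) = restrict y (B d)" using d(1) by (simp add: s_def)
          then show ?thesis using d(2) by (metis restrict_apply')
        next
          case False
          then show ?thesis using PiE_arb[OF y False] PiE_arb[OF YT[OF sp] False] by (simp only:)
        qed
        then show "\<omega> \<in> Y -` {y} \<inter> space N" using sp by auto
      qed (auto simp: s_def)
      also have "prob \<dots> = (\<Prod>d\<in>D. prob ((\<lambda>\<omega>. restrict (Y \<omega>) (B d)) -` {s d} \<inter> space N))"
        by (rule indep_varsD_finite[OF indep False fin(1)]) (auto simp: s_def)
      also have "\<dots> = (\<Prod>d\<in>D. pmf (p d) (s d))" by (intro prod.cong refl prob_p)
      finally show ?thesis .
    qed
    also have "\<dots> = pmf ?P s" using fin(1) by (subst pmf_Pi') (auto simp: s_def)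
    also have "\<dots> = measure_pmf.prob ?P (assemble D B -` {y})"
    proof -
      \<comment> \<open>Gluing forgets \<open>h d\<close> outside \<open>B d\<close> and
        \<open>h\<close> outside \<open>D\<close>, so it is not injective in general. On the support
        of the product law these values are all \<open>undefined\<close>, and \<open>s\<close> is
        the only possible preimage.\<close>
      have "assemble D B -` {y} \<inter> set_pmf ?P \<subseteq> {s}"
      proof
        fix h assume h: "h \<in> assemble D B -` {y} \<inter> set_pmf ?P"
        have hd: "h d \<in> nat_vectors (B d)" if "d \<in> D" for d
        proof -
          have "pmf ?P h \<noteq> 0" using h by (simp add: set_pmf_iff)
          then have "pmf (p d) (h d) \<noteq> 0" using that fin(1) by (auto simp: pmf_Pi split: if_splits)
          then show ?thesis using supp[OF that] by (auto simp: set_pmf_iff)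
        qed
        have "h d = s d" for d
        proof (cases "d \<in> D")
          case True
          have "h d u = restrict y (B d) u" for u
            using assemble_in[OF dis True, of u h] PiE_arb[OF hd[OF True], of u] h by (cases "u \<in> B d") auto
          then show ?thesis using True by (auto simp: s_def)
        next
          case False
          then show ?thesis using h set_Pi_pmf_subset[OF fin(1), of undefined p] by (auto simp: s_def)
        qed
        then show "h \<in> {s}" by auto
      qed
      then have "measure_pmf.prob ?P (assemble D B -` {y}) \<le> measure_pmf.prob ?P {s}"
        by (subst measure_Int_set_pmf[symmetric]) (auto intro!: measure_pmf.finite_measure_mono)
      moreover have "measure_pmf.prob ?P {s} \<le> measure_pmf.prob ?P (assemble D B -` {y})"
        using as by (intro measure_pmf.finite_measure_mono) auto
      ultimately show ?thesis by (simp add: measure_pmf_single)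
    qed
    also have "\<dots> = measure (measure_pmf (map_pmf (assemble D B) ?P)) {y}" by simp
    finally have "measure (distr N (count_space UNIV) Y) {y} = measure (measure_pmf (map_pmf (assemble D B) ?P)) {y}" .
    moreover have "prob_space (distr N (count_space UNIV) Y)" using YU by (rule prob_space_distr)
    ultimately show "emeasure (distr N (count_space UNIV) Y) {y} = emeasure (measure_pmf (map_pmf (assemble D B) ?P)) {y}"
      by (simp add: finite_measure.emeasure_eq_measure prob_space.finite_measure measure_pmf.emeasure_eq_measure)
  qed auto
qed

section \<open>The limit of the boundary servers\<close>

theorem theorem2:
  fixes C :: "'s set" and B :: "nat \<Rightarrow> 's set" and lam mu :: real
    and M :: "nat \<Rightarrow> 'w measure" and X :: "nat \<Rightarrow> 'w \<Rightarrow> 's \<Rightarrow> nat"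
    and D :: "nat set" and N :: "'z measure" and Y :: "'z \<Rightarrow> 's \<Rightarrow> nat"
  defines "BD \<equiv> \<Union>d\<in>D. B d"
  assumes "finite C"
    and "\<And>d. d \<ge> 1 \<Longrightarrow> finite (B d)"
    and "\<And>d. d \<ge> 1 \<Longrightarrow> card (B d) = card (B 1)"
    and "\<And>d. d \<ge> 1 \<Longrightarrow> C \<inter> B d = {}"
    and "disjoint_family_on B {1..}"
    and "lam > 0" and "mu > 0" and "lam < mu * real (card (B 1))"
    and "\<And>n. n \<ge> 1 \<Longrightarrow> prob_space (M n)"
    and "\<And>n. n \<ge> 1 \<Longrightarrow> has_stationary_distribution (nat_vectors (dandelion_servers C B n))
           (dandelion_generator C B lam mu n) (M n) (X n)"
    and "finite D" and "D \<subseteq> {1..}"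
    and "prob_space N"
    and "Y \<in> measurable N (count_space (nat_vectors BD))"
    and "prob_space.indep_vars N (\<lambda>d. count_space (nat_vectors (B d)))
           (\<lambda>d \<omega>. restrict (Y \<omega>) (B d)) D"
    and "\<And>d d'. d \<in> D \<Longrightarrow> d' \<in> D \<Longrightarrow> \<exists>f. bij_betw f (B d) (B d') \<and>
           distr N (count_space (nat_vectors (B d))) (\<lambda>\<omega>. \<lambda>b\<in>B d. Y \<omega> (f b)) =
           distr N (count_space (nat_vectors (B d))) (\<lambda>\<omega>. \<lambda>b\<in>B d. Y \<omega> b)"
    and "\<And>d. d \<in> D \<Longrightarrow> has_stationary_distribution (nat_vectors (B d))
           (basic_generator (B d) lam mu) N (\<lambda>\<omega>. restrict (Y \<omega>) (B d))"
  shows "weak_conv_on (nat_vectors_topology BD)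
           (\<lambda>n. distr (M n) (count_space (nat_vectors BD)) (\<lambda>\<omega>. restrict (X n \<omega>) BD))
           (distr N (count_space (nat_vectors BD)) Y)"
proof -
  note finC = assms(2) and finB = assms(3) and cardB = assms(4) and disC = assms(5)
    and disB = assms(6) and lam = assms(7) and mu = assms(8) and stable = assms(9)
    and X = assms(11) and finD = assms(12) and D1 = assms(13) and N = assms(14) and Y = assms(15)
    and indep = assms(16) and Y_stat = assms(18)
  have dand: "dandelion C B lam mu (card (B 1))"
    by (rule dandelion.intro[OF finC finB cardB disC disB lam mu stable])
  have finBD: "finite BD" using finD finB D1 by (auto simp: BD_def)
  have finBd: "finite (B d)" if "d \<in> D" for d using finB D1 that by auto
  have disD: "disjoint_family_on B D" using disB D1 by (auto simp: disjoint_family_on_def)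
  let ?\<Omega> = "nat_vectors BD" and ?T = "SIGMA d:D. B d"
  interpret T: load_balancing D BD ?T "\<lambda>_. lam" "\<lambda>_. mu"
    by unfold_locales (use finD finBD lam mu in \<open>auto simp: BD_def\<close>)

  have "\<exists>p. load_balancing_invariant {()} (B d) ({()} \<times> B d) (\<lambda>_. lam) (\<lambda>_. mu) p \<and>
      distr N (count_space UNIV) (\<lambda>\<omega>. restrict (Y \<omega>) (B d)) = measure_pmf p" if d: "d \<in> D" for d
  proof -
    interpret load_balancing "{()}" "B d" "{()} \<times> B d" "\<lambda>_. lam" "\<lambda>_. mu"
      by unfold_locales (use finBd[OF d] lam mu in auto)
    show ?thesis
      using Y_stat[OF d] stationary_distribution_imp_invariant
      unfolding has_stationary_distribution_def basic_generator_def by blast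
  qed
  then obtain p where p: "\<And>d. d \<in> D \<Longrightarrow> load_balancing_invariant {()} (B d) ({()} \<times> B d) (\<lambda>_. lam) (\<lambda>_. mu) (p d)"
      "\<And>d. d \<in> D \<Longrightarrow> distr N (count_space UNIV) (\<lambda>\<omega>. restrict (Y \<omega>) (B d)) = measure_pmf (p d)"
    by metis
  \<comment> \<open>The candidate limit: the block laws of \<open>Y\<close> combined independently.
    It is invariant for the network without \<open>C\<close>, and it is the law of
    \<open>Y\<close>.\<close>
  define q where "q = map_pmf (assemble D B) (Pi_pmf D undefined p)"
  have q_inv: "load_balancing_invariant D BD ?T (\<lambda>_. lam) (\<lambda>_. mu) q"
    unfolding q_def BD_def using Pi_pmf_assemble_invariant[OF disD finD finBd _ mu p(1)] lam by simp
  have q: "distr N (count_space UNIV) Y = measure_pmf q"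
    unfolding q_def using distr_indep_eq_Pi_pmf[OF N disD finD finBd _ indep p(2)] Y by (simp add: BD_def)

  have "\<exists>p. load_balancing_invariant {1..n} (dandelion_servers C B n) (dandelion_edges C B n) (\<lambda>_. lam) (\<lambda>_. mu) p \<and>
      distr (M n) (count_space UNIV) (X n) = measure_pmf p" if n: "1 \<le> n" for n
  proof -
    interpret dandelion C B lam mu n "card (B 1)" by (rule dand)
    show ?thesis
      using X[OF n] stationary_distribution_imp_invariant
      unfolding has_stationary_distribution_def dandelion_generator_def by blast
  qed
  then obtain P where P: "\<And>n. 1 \<le> n \<Longrightarrow> load_balancing_invariant {1..n} (dandelion_servers C B n)
        (dandelion_edges C B n) (\<lambda>_. lam) (\<lambda>_. mu) (P n)"
      "\<And>n. 1 \<le> n \<Longrightarrow> distr (M n) (count_space UNIV) (X n) = measure_pmf (P n)"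
    by metis
  obtain n0 where n0: "1 \<le> n0" "D \<subseteq> {1..n0}"
  proof -
    have "D \<subseteq> {1..Max (insert 1 D)}" using D1 finD by auto
    then show thesis using that[of "Max (insert 1 D)"] finD by simp
  qed
  \<comment> \<open>From \<open>n0\<close> on all dispatchers of \<open>D\<close> belong to the
    network; the shift of the index is undone at the end by \<open>LIMSEQ_offset\<close>.\<close>
  define R where "R k = map_pmf (\<lambda>x. restrict x BD) (P (k + n0))" for k
  have n1: "1 \<le> k + n0" "D \<subseteq> {1..k + n0}" for k using n0 by auto

  have tight: "\<exists>F. finite F \<and> (\<forall>k. measure_pmf.prob (R k) F \<ge> 1 - e)" if e: "0 < e" for e
  proof -
    define c where "c = (lam + mu * real (card (B 1))) / (2 * (mu - lam / real (card (B 1))))"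
    have c: "0 \<le> c"
    proof -
      have "0 < card (B 1)" using stable lam mu by (cases "card (B 1) = 0") auto
      then have "0 < mu - lam / real (card (B 1))" using stable by (simp add: field_simps)
      then show ?thesis using lam mu by (simp add: c_def)
    qed
    \<comment> \<open>A union bound over \<open>D\<close> costs \<open>card D * (c / m)\<close>,
      which has to be at most \<open>e\<close>; the added 1 keeps \<open>m\<close> positive when
      \<open>D\<close> is empty.\<close>
    define m where "m = real (card D) * c / e + 1"
    have m: "0 < m" "real (card D) * (c / m) \<le> e"
    proof -
      show "0 < m" using c e by (simp add: m_def add_nonneg_pos)
      moreover have "real (card D) * c \<le> e * m" using e by (simp add: m_def field_simps)
      ultimately show "real (card D) * (c / m) \<le> e" by (simp add: field_simps)
    qed
    define F where "F = BD \<rightarrow>\<^sub>E {..nat \<lceil>m\<rceil>}"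
    have "measure_pmf.prob (R k) F \<ge> 1 - e" for k
    proof -
      interpret dandelion C B lam mu "k + n0" "card (B 1)" by (rule dand)
      let ?I = "\<lambda>d x. of_bool (m \<le> (\<Sum>u\<in>B d. real (x u))) :: real"
      \<comment> \<open>Outside the box \<open>F\<close> some load exceeds \<open>m\<close>, and so
        does the total load of the block that contains it.\<close>
      have ind: "1 - indicator F (restrict x BD) \<le> (\<Sum>d\<in>D. ?I d x)" for x
      proof (cases "restrict x BD \<in> F")
        case True then show ?thesis by (simp add: sum_nonneg)
      next
        case False
        then obtain u where u: "u \<in> BD" "\<not> x u \<le> nat \<lceil>m\<rceil>" by (auto simp: F_def PiE_iff)
        then obtain d where d: "d \<in> D" "u \<in> B d" by (auto simp: BD_def)
        have "m \<le> real (x u)" using u(2) by linarith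
        also have "\<dots> \<le> (\<Sum>u\<in>B d. real (x u))"
          using finBd[OF d(1)] d(2) by (intro member_le_sum) auto
        finally have "1 \<le> ?I d x" by simp
        also have "\<dots> \<le> (\<Sum>d\<in>D. ?I d x)"
          using finD d(1) by (intro member_le_sum) auto
        finally show ?thesis using False by simp
      qed
      have "1 - measure_pmf.prob (R k) F = measure_pmf.expectation (P (k + n0)) (\<lambda>x. 1 - indicator F (restrict x BD))"
      proof -
        have "measure_pmf.prob (R k) F = measure_pmf.expectation (R k) (indicator F)" by simp
        also have "\<dots> = measure_pmf.expectation (P (k + n0)) (\<lambda>x. indicator F (restrict x BD))"
          by (simp add: R_def del: Bochner_Integration.integral_indicator)
        finally show ?thesis
          by (subst Bochner_Integration.integral_diff) (auto intro!: integrable_pmf_bounded[where b=1] split: split_indicator)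
      qed
      also have "\<dots> \<le> measure_pmf.expectation (P (k + n0)) (\<lambda>x. \<Sum>d\<in>D. ?I d x)"
        by (intro integral_mono ind Bochner_Integration.integrable_sum Bochner_Integration.integrable_diff
            integrable_pmf_bounded[where b=1]) (auto split: split_indicator)
      also have "\<dots> = (\<Sum>d\<in>D. measure_pmf.expectation (P (k + n0)) (?I d))"
        by (intro Bochner_Integration.integral_sum integrable_pmf_bounded[where b=1]) auto
      also have "\<dots> \<le> (\<Sum>d\<in>D. c / m)"
      proof (rule sum_mono)
        fix d assume "d \<in> D"
        then have "d \<in> {1..k + n0}" using n1 by blast
        from prob_boundary_large_le[OF P(1)[OF n1(1)] this m(1)]
        show "measure_pmf.expectation (P (k + n0)) (?I d) \<le> c / m" by (simp add: c_def)
      qed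
      also have "\<dots> \<le> e" using m(2) by simp
      finally show ?thesis by simp
    qed
    moreover have "finite F" unfolding F_def using finBD by (intro finite_PiE) auto
    ultimately show ?thesis by blast
  qed

  \<comment> \<open>Along the subsequence the expectation of \<open>T.L g\<close> is bounded by an
    error of order \<open>1 / n\<close>; since \<open>T.L g\<close> is bounded, it converges to the
    expectation under \<open>q'\<close>, which is therefore 0.\<close>
  have unique: "q' = q" if r: "strict_mono r" and q': "set_pmf q' \<subseteq> ?\<Omega>"
    and lim: "\<And>x. (\<lambda>k. pmf (R (r k)) x) \<longlonglongrightarrow> pmf q' x" for r q'
  proof (rule T.invariant_unique[OF _ q_inv], unfold load_balancing_invariant_def, intro conjI allI impI)
    fix g :: "('s \<Rightarrow> nat) \<Rightarrow> real" and b assume b: "\<forall>x. \<bar>g x\<bar> \<le> b"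
    let ?c = "\<lambda>n. real (card D) * (4 * b * lam * (real (card (B 1) + card C) * (mu * real (card C) / (lam * real n))))"
    have le: "\<bar>measure_pmf.expectation (R (r k)) (T.L g)\<bar> \<le> ?c (r k + n0)" for k
    proof -
      interpret dandelion C B lam mu "r k + n0" "card (B 1)" by (rule dand)
      show ?thesis
        using expectation_boundary_operator_le[OF P(1)[OF n1(1)] n1(2), of g b] b
        by (simp only: R_def BD_def)
    qed
    have "(\<lambda>k. ?c (r k + n0)) \<longlonglongrightarrow> 0"
    proof -
      have "(\<lambda>n. (mu * real (card C) / lam) / real n) \<longlonglongrightarrow> 0" by (rule lim_const_over_n)
      then have "(\<lambda>n. mu * real (card C) / (lam * real n)) \<longlonglongrightarrow> 0" by simp
      then have "?c \<longlonglongrightarrow> 0" by (intro tendsto_mult_right_zero)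
      then have "(\<lambda>k. ?c (k + n0)) \<longlonglongrightarrow> 0" by (rule LIMSEQ_ignore_initial_segment)
      from LIMSEQ_subseq_LIMSEQ[OF this r] show ?thesis by (simp add: comp_def)
    qed
    then have "(\<lambda>k. measure_pmf.expectation (R (r k)) (T.L g)) \<longlonglongrightarrow> 0"
      by (rule Lim_null_comparison[rotated]) (simp only: real_norm_def le eventually_True)
    moreover have "(\<lambda>k. measure_pmf.expectation (R (r k)) (T.L g)) \<longlonglongrightarrow> measure_pmf.expectation q' (T.L g)"
      by (rule pointwise_imp_expectation_tendsto[OF lim T.operator_abs_le]) (use b in auto)
    ultimately show "measure_pmf.expectation q' (T.L g) = 0" using LIMSEQ_unique by blast
  qed (rule q')

  have R_sub: "set_pmf (R k) \<subseteq> ?\<Omega>" for k by (auto simp: R_def)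
  have cnt: "countable ?\<Omega>" using finBD by (intro countable_PiE) auto
  have q_sub: "set_pmf q \<subseteq> ?\<Omega>" using q_inv by (simp add: load_balancing_invariant_def)
  show ?thesis
    unfolding weak_conv_on_def
  proof (intro allI impI)
    fix f :: "('s \<Rightarrow> nat) \<Rightarrow> real"
    assume "continuous_map (nat_vectors_topology BD) euclideanreal f \<and> bounded (f ` topspace (nat_vectors_topology BD))"
    then have "bounded (f ` ?\<Omega>)" by simp
    then obtain b where b: "\<And>x. x \<in> ?\<Omega> \<Longrightarrow> \<bar>f x\<bar> \<le> b" by (auto simp: bounded_iff)
    \<comment> \<open>The bound on \<open>f\<close> is available on \<open>nat_vectors BD\<close>
      only, whereas the convergence lemma wants it everywhere. Extension by 0 changes no integral,
      as all laws live on this set.\<close>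
    define f' where "f' x = (if x \<in> ?\<Omega> then f x else 0)" for x
    have f'b: "\<bar>f' x\<bar> \<le> \<bar>b\<bar>" for x using b[of x] by (auto simp: f'_def)
    have conv: "(\<lambda>k. measure_pmf.expectation (R k) f') \<longlonglongrightarrow> measure_pmf.expectation q f'"
      by (rule tight_pmf_tendsto[OF cnt R_sub tight unique f'b])
    have "integral\<^sup>L (distr (M (k + n0)) (count_space ?\<Omega>) (\<lambda>\<omega>. restrict (X (k + n0) \<omega>) BD)) f
        = measure_pmf.expectation (R k) f'" for k
    proof -
      let ?n = "k + n0"
      have XU: "X ?n \<in> measurable (M ?n) (count_space UNIV)"
        using X[OF n1(1)[of k]] unfolding has_stationary_distribution_def
        by (elim conjE) (rule measurable_count_space_superset[OF _ subset_UNIV])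
      have "(\<lambda>x. restrict x BD) \<in> measurable (count_space UNIV) (count_space ?\<Omega>)" by auto
      then have "(\<lambda>\<omega>. restrict (X ?n \<omega>) BD) \<in> measurable (M ?n) (count_space ?\<Omega>)"
        by (rule measurable_compose[OF XU])
      then have "integral\<^sup>L (distr (M ?n) (count_space ?\<Omega>) (\<lambda>\<omega>. restrict (X ?n \<omega>) BD)) f
          = (\<integral>\<omega>. f (restrict (X ?n \<omega>) BD) \<partial>M ?n)" by (rule integral_distr) simp
      also have "\<dots> = (\<integral>x. f (restrict x BD) \<partial>distr (M ?n) (count_space UNIV) (X ?n))"
        using XU by (subst integral_distr) auto
      also have "\<dots> = measure_pmf.expectation (R k) f"
        unfolding P(2)[OF n1(1)] R_def by simp
      also have "\<dots> = measure_pmf.expectation (R k) f'"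
        using R_sub[of k] by (intro integral_cong_AE) (auto simp: AE_measure_pmf_iff f'_def)
      finally show ?thesis .
    qed
    moreover have "integral\<^sup>L (distr N (count_space ?\<Omega>) Y) f = measure_pmf.expectation q f'"
    proof -
      have "integral\<^sup>L (distr N (count_space ?\<Omega>) Y) f = (\<integral>\<omega>. f (Y \<omega>) \<partial>N)"
        using Y by (rule integral_distr) simp
      also have "\<dots> = integral\<^sup>L (distr N (count_space UNIV) Y) f"
        by (subst integral_distr) (auto intro: measurable_count_space_superset[OF Y])
      also have "\<dots> = measure_pmf.expectation q f'"
        unfolding q using q_sub by (intro integral_cong_AE) (auto simp: AE_measure_pmf_iff f'_def)
      finally show ?thesis .
    qed
    ultimately have "(\<lambda>k. integral\<^sup>L (distr (M (k + n0)) (count_space ?\<Omega>) (\<lambda>\<omega>. restrict (X (k + n0) \<omega>) BD)) f)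
        \<longlonglongrightarrow> integral\<^sup>L (distr N (count_space ?\<Omega>) Y) f" using conv by simp
    then show "(\<lambda>n. integral\<^sup>L (distr (M n) (count_space ?\<Omega>) (\<lambda>\<omega>. restrict (X n \<omega>) BD)) f)
        \<longlonglongrightarrow> integral\<^sup>L (distr N (count_space ?\<Omega>) Y) f" by (rule LIMSEQ_offset)
  qed
qed

end
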